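(* Let $0<\alpha<\beta<\pi$ and let $c_{\alpha\beta}>0$ be a constant. Suppose there exists an entire solution $V(t,x,y)$ of $u_t-\Delta u=f(x,y,u)$ on $\mathbb{R}\times\mathbb{R}^2$ satisfying $$\lim_{R\to+\infty}\ \sup_{x^2+(y-c_{\alpha\beta}t)^2>R^2}\big|V(t,x,y)-U^-_{\alpha\beta}(t,x,y)\big|=0,$$ the supremum being over all $(t,x,y)\in\mathbb{R}\times\mathbb{R}^2$ satisfying the indicated inequality. Then $$c_{\alpha\beta}=\frac{c_\alpha}{\sin\alpha}=\frac{c_\beta}{\sin\beta}>\frac{c_\theta}{\sin\theta}\quad\text{for every }\theta\in(\alpha,\beta).$$
   Context: Let $L=(L_1,L_2)$ with $L_1,L_2>0$ and $\mathbb{T}^2=[0,L_1]\times[0,L_2]$ (periodicity cell). The equation is $u_t-\Delta u=f(x,y,u)$, $(t,x,y)\in\mathbb{R}\times\mathbb{R}^2$, $\Delta=\partial_{xx}+\partial_{yy}$. Assumptions on $f$: (F1) $f$ is continuous, of class $C^{a}$ in $(x,y)$ uniformly in $u\in[0,1]$ for some $a\in(0,1)$, of class $C^2$ in $u$ uniformly in $(x,y)\in\mathbb{R}^2$, with $f_u,f_{uu}$ Lipschitz continuous in $u\in\mathbb{R}$; (F2) $f(x+k_1L_1,y+k_2L_2,u)=f(x,y,u)$ for all $k_1,k_2\in\mathbb{Z}$; (F3) $f(x,y,0)=f(x,y,1)=0$ for all $(x,y)$, and there are $\lambda>0$, $\sigma\in(0,1/2)$ with $-f_u(x,y,u)\ge\lambda$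 for all $(x,y)\in\mathbb{R}^2$ and $u\in[0,\sigma]\cup[1-\sigma,1]$; moreover $f$ is extended outside $u\in[0,1]$ so that $-f_u\ge\lambda$ for $u\in(-\infty,\sigma]\cup[1-\sigma,+\infty)$, and $f$ is globally Lipschitz in $u$. A pulsating front in the unit direction $e\in\mathbb{S}\subset\mathbb{R}^2$ (connecting $0$ and $1$) with speed $c_e\in\mathbb{R}$ is a pair $(U_e,c_e)$, $U_e:\mathbb{R}\times\mathbb{T}^2\to\mathbb{R}$, with $U_e(\xi,x,y)$ $L$-periodic in $(x,y)$, $U_e(+\infty,x,y)=0$ and $U_e(-\infty,x,y)=1$ uniformly in $(x,y)$, and such that $u(t,x,y)=U_e((x,y)\cdot e-c_et,x,y)$ is a classical entire solution of the equation. Standing assumptions: $\int_{\mathbb{T}^2\times[0,1]}f(x,y,u)\,dx\,dy\,du>0$, and for every unit vector $e$ there is a pulsating front $(U_e,c_e)$ with $c_e\ne0$. Known consequences: $c_e>0$ for all $e$; $c_e$ is unique and $U_e$ is unique up to shifts in $\xi$, and is normalized by $U_e(0,0,0)=1/2$. Notation: for an angle $\theta$, $U_\theta:=U_{(\cos\theta,\sin\theta)}$ and $c_\theta:=c_{(\cos\theta,\sin\theta)}$. For $\alpha,\beta\in(0,\pi)$, $$U^-_{\alpha\beta}(t,x,y):=\max\{U_\alpha(x\cos\alpha+y\sin\alpha-c_\alpha t,x,y),\ U_\beta(x\cos\beta+y\sin\beta-c_\beta t,x,y)\}.$$ *)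

theory Defs
  imports "HOL-Analysis.Analysis"
begin

text \<open>
  The reaction term is a function \<open>f x y u\<close>, and a function of time and space is written
  \<open>u t x y\<close>.
\<close>

definition f_u :: "(real \<Rightarrow> real \<Rightarrow> real \<Rightarrow> real) \<Rightarrow> real \<Rightarrow> real \<Rightarrow> real \<Rightarrow> real" where
  "f_u f x y u = deriv (f x y) u"

definition f_uu :: "(real \<Rightarrow> real \<Rightarrow> real \<Rightarrow> real) \<Rightarrow> real \<Rightarrow> real \<Rightarrow> real \<Rightarrow> real" where
  "f_uu f x y u = deriv (f_u f x y) u"

text \<open>
  Uniformity in \<open>(x, y)\<close> means that the constants below do not depend on \<open>(x, y)\<close>. In the
  presence of \<open>F3\<close>, which bounds \<open>f_u\<close>, the Lipschitz bounds make \<open>f x y\<close> of class \<open>C\<^sup>2\<close> in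
  \<open>u\<close> uniformly: the bound on \<open>f_u\<close> bounds \<open>f_uu\<close>, and the one on \<open>f_uu\<close> gives its
  equicontinuity.
\<close>

definition F1 :: "(real \<Rightarrow> real \<Rightarrow> real \<Rightarrow> real) \<Rightarrow> bool" where
  "F1 f \<longleftrightarrow>
     continuous_on UNIV (\<lambda>(x, y, u). f x y u) \<and>
     (\<exists>a\<in>{0<..<1}. \<exists>K. \<forall>u\<in>{0..1}. \<forall>x y x' y'.
        \<bar>f x y u - f x' y' u\<bar> \<le> K * dist (x, y) (x', y') powr a) \<and>
     (\<forall>x y u. (f x y has_real_derivative f_u f x y u) (at u)) \<and>
     (\<forall>x y u. (f_u f x y has_real_derivative f_uu f x y u) (at u)) \<and>
     (\<exists>K. \<forall>x y. K-lipschitz_on UNIV (f_u f x y)) \<and>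
     (\<exists>K. \<forall>x y. K-lipschitz_on UNIV (f_uu f x y))"

definition F2 :: "real \<Rightarrow> real \<Rightarrow> (real \<Rightarrow> real \<Rightarrow> real \<Rightarrow> real) \<Rightarrow> bool" where
  "F2 L1 L2 f \<longleftrightarrow>
     (\<forall>(k1::int) (k2::int) x y u. f (x + of_int k1 * L1) (y + of_int k2 * L2) u = f x y u)"

text \<open>The condition on \<open>f_u\<close> includes the extension of \<open>f\<close> outside \<open>{0..1}\<close>.\<close>

definition F3 :: "(real \<Rightarrow> real \<Rightarrow> real \<Rightarrow> real) \<Rightarrow> bool" where
  "F3 f \<longleftrightarrow>
     (\<forall>x y. f x y 0 = 0 \<and> f x y 1 = 0) \<and>
     (\<exists>\<kappa>>0. \<exists>\<sigma>\<in>{0<..<1/2}. \<forall>x y. \<forall>u\<in>{..\<sigma>} \<union> {1-\<sigma>..}. - f_u f x y u \<ge> \<kappa>) \<and>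
     (\<exists>K. \<forall>x y. K-lipschitz_on UNIV (f x y))"

definition D_t :: "(real \<Rightarrow> real \<Rightarrow> real \<Rightarrow> real) \<Rightarrow> real \<Rightarrow> real \<Rightarrow> real \<Rightarrow> real" where
  "D_t u t x y = deriv (\<lambda>s. u s x y) t"

definition D_x :: "(real \<Rightarrow> real \<Rightarrow> real \<Rightarrow> real) \<Rightarrow> real \<Rightarrow> real \<Rightarrow> real \<Rightarrow> real" where
  "D_x u t x y = deriv (\<lambda>s. u t s y) x"

definition D_y :: "(real \<Rightarrow> real \<Rightarrow> real \<Rightarrow> real) \<Rightarrow> real \<Rightarrow> real \<Rightarrow> real \<Rightarrow> real" where
  "D_y u t x y = deriv (\<lambda>s. u t x s) y"

definition continuous3 :: "(real \<Rightarrow> real \<Rightarrow> real \<Rightarrow> real) \<Rightarrow> bool" where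
  "continuous3 u \<longleftrightarrow> continuous_on UNIV (\<lambda>(t, x, y). u t x y)"

definition C1_t :: "(real \<Rightarrow> real \<Rightarrow> real \<Rightarrow> real) \<Rightarrow> bool" where
  "C1_t u \<longleftrightarrow>
     (\<forall>t x y. ((\<lambda>s. u s x y) has_real_derivative D_t u t x y) (at t)) \<and> continuous3 (D_t u)"

definition C1_xy :: "(real \<Rightarrow> real \<Rightarrow> real \<Rightarrow> real) \<Rightarrow> bool" where
  "C1_xy u \<longleftrightarrow>
     (\<forall>t x y. ((\<lambda>s. u t s y) has_real_derivative D_x u t x y) (at x)) \<and>
     (\<forall>t x y. ((\<lambda>s. u t x s) has_real_derivative D_y u t x y) (at y)) \<and>
     continuous3 (D_x u) \<and> continuous3 (D_y u)"

text \<open>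
  A classical entire solution is of class \<open>C\<^sup>1\<close> in \<open>t\<close> and \<open>C\<^sup>2\<close> in \<open>(x, y)\<close>, the derivatives
  being jointly continuous in \<open>(t, x, y)\<close>, and solves \<open>u_t - \<Delta>u = f(x, y, u)\<close> pointwise.
\<close>

definition classical_entire_solution ::
  "(real \<Rightarrow> real \<Rightarrow> real \<Rightarrow> real) \<Rightarrow> (real \<Rightarrow> real \<Rightarrow> real \<Rightarrow> real) \<Rightarrow> bool" where
  "classical_entire_solution f u \<longleftrightarrow>
     continuous3 u \<and> C1_t u \<and> C1_xy u \<and> C1_xy (D_x u) \<and> C1_xy (D_y u) \<and>
     (\<forall>t x y. D_t u t x y - (D_x (D_x u) t x y + D_y (D_y u) t x y) = f x y (u t x y))"

text \<open>A function on the torus is a function on the plane that is periodic in \<open>(x, y)\<close>.\<close>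

definition pulsating_front ::
  "real \<Rightarrow> real \<Rightarrow> (real \<Rightarrow> real \<Rightarrow> real \<Rightarrow> real) \<Rightarrow> real \<times> real
     \<Rightarrow> (real \<Rightarrow> real \<Rightarrow> real \<Rightarrow> real) \<Rightarrow> real \<Rightarrow> bool" where
  "pulsating_front L1 L2 f e U c \<longleftrightarrow>
     (\<forall>(k1::int) (k2::int) \<xi> x y. U \<xi> (x + of_int k1 * L1) (y + of_int k2 * L2) = U \<xi> x y) \<and>
     uniform_limit UNIV (\<lambda>\<xi> (x, y). U \<xi> x y) (\<lambda>_. 0) at_top \<and>
     uniform_limit UNIV (\<lambda>\<xi> (x, y). U \<xi> x y) (\<lambda>_. 1) at_bot \<and>
     classical_entire_solution f (\<lambda>t x y. U ((x, y) \<bullet> e - c * t) x y)"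

definition dir :: "real \<Rightarrow> real \<times> real" where
  "dir \<theta> = (cos \<theta>, sin \<theta>)"

text \<open>
  Here \<open>U\<close> and \<open>c\<close> are the families of profiles and speeds, indexed by the direction.
\<close>

definition U_minus ::
  "(real \<times> real \<Rightarrow> real \<Rightarrow> real \<Rightarrow> real \<Rightarrow> real) \<Rightarrow> (real \<times> real \<Rightarrow> real)
     \<Rightarrow> real \<Rightarrow> real \<Rightarrow> real \<Rightarrow> real \<Rightarrow> real \<Rightarrow> real" where
  "U_minus U c \<alpha> \<beta> t x y =
     max (U (dir \<alpha>) (x * cos \<alpha> + y * sin \<alpha> - c (dir \<alpha>) * t) x y)
         (U (dir \<beta>) (x * cos \<beta> + y * sin \<beta> - c (dir \<beta>) * t) x y)"

end

theory Submission
  imports Defs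
begin

text \<open>
  Write \<open>\<xi>\<^sub>\<phi> = x cos \<phi> + y sin \<phi>\<close>. The level sets of \<open>U_minus\<close> follow the boundary of the
  union of the half planes \<open>\<xi>\<^sub>\<alpha> < c\<^sub>\<alpha> t\<close> and \<open>\<xi>\<^sub>\<beta> < c\<^sub>\<beta> t\<close>, in which the two fronts are
  close to 1. This is a V-shaped curve whose corner moves with the constant velocity \<open>v\<close>
  given by \<open>v \<bullet> dir \<alpha> = c\<^sub>\<alpha>\<close> and \<open>v \<bullet> dir \<beta> = c\<^sub>\<beta>\<close>.

  \<^bold>\<open>The two speeds.\<close> If \<open>v \<noteq> (0, c\<^sub>\<alpha>\<^sub>\<beta>)\<close>, then the corner moves away from the point
  \<open>(0, c\<^sub>\<alpha>\<^sub>\<beta> t)\<close>, so at late times \<open>V\<close> is as close as desired to the maximum of two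
  solutions in a large neighbourhood of the corner. A maximum of two solutions that cross
  is not a solution: on one side of the corner \<open>V - U\<^sub>\<alpha>\<close> is almost zero, although it is
  almost nonnegative and, one unit of time earlier, was large on a ball nearby. A
  quantitative strong maximum principle (\<open>positivity_spreads\<close>) excludes this, with
  constants that depend only on the distances involved. This is \<open>corner_velocity\<close>; it says
  \<open>c\<^sub>\<alpha> = c\<^sub>\<alpha>\<^sub>\<beta> sin \<alpha>\<close> and \<open>c\<^sub>\<beta> = c\<^sub>\<alpha>\<^sub>\<beta> sin \<beta>\<close>.

  \<^bold>\<open>The strict inequality.\<close> Suppose \<open>c\<^sub>\<theta> \<ge> c\<^sub>\<alpha>\<^sub>\<beta> sin \<theta>\<close> for an angle \<open>\<theta>\<close> between \<open>\<alpha>\<close> and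
  \<open>\<beta>\<close>. Place the profile \<open>U\<^sub>\<theta>\<close> in the frame that moves upwards with speed \<open>c\<^sub>\<alpha>\<^sub>\<beta>\<close>, shifted
  by \<open>r\<close>. For large \<open>r\<close> its interface is a line below the V-shaped curve, and \<open>V\<close> is
  eventually above it. Let \<open>r\<close> decrease: the set of the shifts for which \<open>V\<close> is eventually
  above the profile up to arbitrarily small errors is closed. It is also open. Indeed, the
  slope of the line lies strictly between the slopes of the two arms, so far away from the
  corner the line is far below the V-shaped curve. A value of the profile that exceeds \<open>V\<close>
  there shares with it a range where \<open>f\<close> is decreasing, and such errors decay
  exponentially (\<open>comparison_damped\<close>); near the corner \<open>positivity_spreads\<close> gives a gap of
  fixed size. Since the front \<open>U\<^sub>\<theta>\<close> is at least as fast as the frame, a solution that has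
  the shift \<open>r\<close> at some time had shifts \<open>\<ge> r\<close> at all earlier times, so both principles can
  be applied to it. Hence \<open>V\<close> lies eventually above the profile for every shift, which is
  absurd at points above the corner, where \<open>V\<close> is small. Every comparison with \<open>V\<close> runs
  forward in time from a fixed instant, since nothing is known about the size of \<open>V\<close> near
  the corner as \<open>t \<rightarrow> -\<infinity>\<close>.
\<close>

section \<open>Maximum principles\<close>

lemma second_derivative_nonpos_at_max:
  fixes g g' :: "real \<Rightarrow> real"
  assumes g: "\<And>s. (g has_real_derivative g' s) (at s)"
    and g': "(g' has_real_derivative g2) (at x)"
    and max: "\<forall>\<^sub>F s in at x. g s \<le> g x"
  shows "g2 \<le> 0"
proof (rule ccontr)
  assume "\<not> g2 \<le> 0"
  then have "g2 > 0" by simp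
  obtain d where d: "d > 0" "\<And>s. s \<noteq> x \<Longrightarrow> dist s x < d \<Longrightarrow> g s \<le> g x"
    using max unfolding eventually_at by auto
  have "g' x = 0"
    by (rule DERIV_local_max[OF g d(1)]) (metis d(2) dist_real_def order_refl abs_minus_commute)
  obtain e where e: "e > 0" "\<And>h. 0 < h \<Longrightarrow> h < e \<Longrightarrow> g' x < g' (x + h)"
    using DERIV_pos_inc_right[OF g' \<open>g2 > 0\<close>] by blast
  define h where "h = min d e / 2"
  have h: "0 < h" "h < d" "h < e" using d e by (auto simp: h_def)
  obtain z where z: "x < z" "z < x + h" "g (x + h) - g x = (x + h - x) * g' z"
    using MVT2[of x "x + h" g g'] g h by auto
  have "g' z > 0" using e(2)[of "z - x"] z h \<open>g' x = 0\<close> by auto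
  then have "g (x + h) > g x" using z h by (smt (verit) mult_pos_pos)
  moreover have "g (x + h) \<le> g x" using d(2)[of "x + h"] h by (auto simp: dist_real_def)
  ultimately show False by simp
qed

text \<open>
  At the final time of a cylinder only the past can be compared, hence the one-sided
  filter in \<open>t\<close>.
\<close>

lemma parabolic_inequality_at_max:
  fixes w :: "real \<Rightarrow> real \<Rightarrow> real \<Rightarrow> real"
  assumes t: "((\<lambda>s. w s x y) has_real_derivative a) (at t)"
    and x: "\<And>s. ((\<lambda>s. w t s y) has_real_derivative wx s) (at s)"
      "(wx has_real_derivative wxx) (at x)"
    and y: "\<And>s. ((\<lambda>s. w t x s) has_real_derivative wy s) (at s)"
      "(wy has_real_derivative wyy) (at y)"
    and max: "\<forall>\<^sub>F s in at_left t. w s x y \<le> w t x y"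
      "\<forall>\<^sub>F s in at x. w t s y \<le> w t x y" "\<forall>\<^sub>F s in at y. w t x s \<le> w t x y"
  shows "a \<ge> wxx + wyy"
proof -
  have "wxx \<le> 0" using second_derivative_nonpos_at_max[OF x max(2)] .
  moreover have "wyy \<le> 0" using second_derivative_nonpos_at_max[OF y max(3)] .
  moreover have "a \<ge> 0"
  proof (rule ccontr)
    assume "\<not> a \<ge> 0"
    then obtain d where d: "d > 0" "\<And>h. 0 < h \<Longrightarrow> h < d \<Longrightarrow> w t x y < w (t - h) x y"
      using DERIV_neg_dec_left[OF t] by auto
    obtain b where b: "b < t" "\<And>s. b < s \<Longrightarrow> s < t \<Longrightarrow> w s x y \<le> w t x y"
      using max(1) unfolding eventually_at_left_field by auto
    define h where "h = min d (t - b) / 2"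
    have "0 < h" "h < d" "b < t - h" using d b by (auto simp: h_def min_def field_simps)
    then show False using d(2)[of h] b(2)[of "t - h"] by auto
  qed
  ultimately show ?thesis by simp
qed

lemma classical_entire_solutionD:
  assumes "classical_entire_solution f u"
  shows "((\<lambda>s. u s x y) has_real_derivative D_t u t x y) (at t)"
    and "((\<lambda>s. u t s y) has_real_derivative D_x u t x y) (at x)"
    and "((\<lambda>s. D_x u t s y) has_real_derivative D_x (D_x u) t x y) (at x)"
    and "((\<lambda>s. u t x s) has_real_derivative D_y u t x y) (at y)"
    and "((\<lambda>s. D_y u t x s) has_real_derivative D_y (D_y u) t x y) (at y)"
    and "D_t u t x y - (D_x (D_x u) t x y + D_y (D_y u) t x y) = f x y (u t x y)"
    and "continuous_on UNIV (\<lambda>(t, x, y). u t x y)"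
  using assms
  unfolding classical_entire_solution_def C1_t_def C1_xy_def continuous3_def by simp_all

lemma classical_entire_solution_const:
  assumes "\<And>x y. f x y k = 0"
  shows "classical_entire_solution f (\<lambda>t x y. k)"
  using assms
  by (simp add: classical_entire_solution_def C1_t_def C1_xy_def continuous3_def
      D_t_def D_x_def D_y_def split_def)

lemma classical_entire_solution_time_shift:
  assumes u: "classical_entire_solution f u"
  shows "classical_entire_solution f (\<lambda>t. u (t + \<tau>))"
proof -
  have shift: "((\<lambda>s. u (s + \<tau>) x y) has_real_derivative D_t u (t + \<tau>) x y) (at t)" for t x y
    using iffD1[OF DERIV_shift classical_entire_solutionD(1)[OF u, of x y "t + \<tau>"]] .
  have dt: "D_t (\<lambda>t. u (t + \<tau>)) = (\<lambda>t. D_t u (t + \<tau>))"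
  proof (intro ext)
    show "D_t (\<lambda>t. u (t + \<tau>)) t x y = D_t u (t + \<tau>) x y" for t x y
      using DERIV_imp_deriv[OF shift] by (simp add: D_t_def)
  qed
  have dx: "D_x (\<lambda>t. v (t + \<tau>)) = (\<lambda>t. D_x v (t + \<tau>))"
    and dy: "D_y (\<lambda>t. v (t + \<tau>)) = (\<lambda>t. D_y v (t + \<tau>))" for v
    by (simp_all add: D_x_def D_y_def fun_eq_iff)
  have cont: "continuous3 (\<lambda>t. v (t + \<tau>))" if "continuous3 v" for v
    unfolding continuous3_def split_def
    using continuous_on_compose2[OF that[unfolded continuous3_def split_def],
        of UNIV "\<lambda>p. (fst p + \<tau>, fst (snd p), snd (snd p))"]
    by (simp add: continuous_intros)
  show ?thesis
    using u cont
    unfolding classical_entire_solution_def C1_t_def C1_xy_def dt dx dy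
    by (simp add: shift)
qed

text \<open>
  The form in which the stability of the states 0 and 1 enters: the reaction contracts any
  two values that are ordered and lie in a common monotone range of \<open>f\<close>. It suffices to
  bound the upper value by \<open>\<sigma>\<close> or the lower one by \<open>1 - \<sigma>\<close>.
\<close>

definition damped :: "(real \<Rightarrow> real \<Rightarrow> real \<Rightarrow> real) \<Rightarrow> real \<Rightarrow> real \<Rightarrow> bool" where
  "damped f \<kappa> \<sigma> \<longleftrightarrow> (\<forall>x y u v. v < u \<longrightarrow> u \<le> \<sigma> \<or> 1 - \<sigma> \<le> v \<longrightarrow>
      f x y u - f x y v \<le> - \<kappa> * (u - v))"

lemma damped_if_derivative_bound:
  assumes d: "\<And>x y u. (f x y has_real_derivative f_u f x y u) (at u)"
    and k: "\<And>x y u. u \<in> {..\<sigma>} \<union> {1-\<sigma>..} \<Longrightarrow> - f_u f x y u \<ge> \<kappa>"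
  shows "damped f \<kappa> \<sigma>"
  unfolding damped_def
proof (intro allI impI)
  fix x y u v :: real
  assume a: "v < u" "u \<le> \<sigma> \<or> 1 - \<sigma> \<le> v"
  obtain z where z: "v < z" "z < u" "f x y u - f x y v = (u - v) * f_u f x y z"
    using MVT2[of v u "f x y" "f_u f x y"] a d by auto
  have "f_u f x y z \<le> - \<kappa>" using k[of z x y] z a by force
  then show "f x y u - f x y v \<le> - \<kappa> * (u - v)"
    using z a mult_left_mono[of "f_u f x y z" "-\<kappa>" "u - v"] by (simp add: mult.commute)
qed

text \<open>
  Where \<open>u > v\<close>, the difference satisfies \<open>z\<^sub>t - \<Delta>z \<le> - \<kappa> z\<close>, so the spatially constant
  solution \<open>M exp (- \<kappa> (t - T))\<close> of the corresponding equation stays above it. On the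
  whole plane a maximum need not be attained; the penalty \<open>\<epsilon> (x\<^sup>2 + y\<^sup>2 + 1 + 5 (t - T))\<close>
  forces this, and it is a strict supersolution of the heat equation because
  \<open>5 > 4 = \<Delta> (x\<^sup>2 + y\<^sup>2)\<close>.
\<close>

lemma comparison_damped:
  fixes u v :: "real \<Rightarrow> real \<Rightarrow> real \<Rightarrow> real"
  assumes u: "classical_entire_solution f u" and v: "classical_entire_solution f v"
    and "\<kappa> > 0" "M \<ge> 0"
    and init: "\<And>x y. u T x y - v T x y \<le> M"
    and bdd: "\<And>t x y. T \<le> t \<Longrightarrow> t \<le> T' \<Longrightarrow> u t x y - v t x y \<le> B"
    and damp: "\<And>t x y. T \<le> t \<Longrightarrow> t \<le> T' \<Longrightarrow> v t x y < u t x y \<Longrightarrow>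
      f x y (u t x y) - f x y (v t x y) \<le> - \<kappa> * (u t x y - v t x y)"
    and "T \<le> t" "t \<le> T'"
  shows "u t x y - v t x y \<le> M * exp (- \<kappa> * (t - T))"
proof -
  define E where "E \<epsilon> t x y = M * exp (- \<kappa> * (t - T)) + \<epsilon> * (x\<^sup>2 + y\<^sup>2 + 1 + 5 * (t - T))"
    for \<epsilon> t x y :: real
  define w where "w \<epsilon> t x y = u t x y - v t x y - E \<epsilon> t x y" for \<epsilon> t x y
  have main: "w \<epsilon> t x y \<le> 0" if \<epsilon>: "\<epsilon> > 0" for \<epsilon>
  proof (rule ccontr)
    assume pos: "\<not> w \<epsilon> t x y \<le> 0"
    \<comment> \<open>outside the square of half width \<open>\<rho>\<close> the penalty exceeds the bound \<open>B\<close>, and the point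
      with \<open>w > 0\<close> lies inside\<close>
    define \<rho> where "\<rho> = \<bar>B\<bar> / \<epsilon> + \<bar>x\<bar> + \<bar>y\<bar> + 1"
    have \<rho>: "\<rho> \<ge> 1" "\<bar>x\<bar> \<le> \<rho>" "\<bar>y\<bar> \<le> \<rho>" "\<bar>B\<bar> \<le> \<epsilon> * \<rho>"
      using \<epsilon> by (auto simp: \<rho>_def field_simps)
    define Q where "Q = {T..T'} \<times> {-\<rho>..\<rho>} \<times> {-\<rho>..\<rho>}"
    have "compact Q" unfolding Q_def by (intro compact_Times) auto
    moreover have mem: "(t, x, y) \<in> Q" using \<rho> assms by (auto simp: Q_def)
    moreover have cw: "continuous_on Q (\<lambda>(t, x, y). w \<epsilon> t x y)"
      using continuous_on_subset[OF classical_entire_solutionD(7)[OF u], of Q]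
        continuous_on_subset[OF classical_entire_solutionD(7)[OF v], of Q]
      unfolding w_def E_def split_def by (auto intro!: continuous_intros)
    ultimately obtain p where p: "p \<in> Q"
      "\<And>p'. p' \<in> Q \<Longrightarrow> (\<lambda>(t, x, y). w \<epsilon> t x y) p' \<le> (\<lambda>(t, x, y). w \<epsilon> t x y) p"
      using continuous_attains_sup[of Q "\<lambda>(t, x, y). w \<epsilon> t x y"] by blast
    obtain a b c where abc: "p = (a, b, c)" by (cases p) auto
    have ab: "T \<le> a" "a \<le> T'" using p by (auto simp: Q_def abc)
    have maxQ: "w \<epsilon> s x' y' \<le> w \<epsilon> a b c" if "(s, x', y') \<in> Q" for s x' y'
      using p(2)[OF that] by (simp add: abc)
    have posmax: "w \<epsilon> a b c > 0" using maxQ[OF mem] pos by simp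
    have max: "w \<epsilon> s x' y' \<le> w \<epsilon> a b c" if s: "T \<le> s" "s \<le> T'" for s x' y'
    proof (cases "(s, x', y') \<in> Q")
      case True then show ?thesis by (rule maxQ)
    next
      case False
      then have "\<bar>x'\<bar> > \<rho> \<or> \<bar>y'\<bar> > \<rho>" using s by (auto simp: Q_def)
      then have "\<rho>\<^sup>2 \<le> x'\<^sup>2 \<or> \<rho>\<^sup>2 \<le> y'\<^sup>2"
        using \<rho>(1) by (auto simp: abs_le_square_iff[symmetric])
      then have "x'\<^sup>2 + y'\<^sup>2 \<ge> \<rho>\<^sup>2"
        using zero_le_power2[of x'] zero_le_power2[of y'] by linarith
      moreover have "\<rho>\<^sup>2 \<ge> \<rho>" using \<rho> by (simp add: power2_eq_square)
      ultimately have "\<epsilon> * (x'\<^sup>2 + y'\<^sup>2 + 1 + 5 * (s - T)) \<ge> \<epsilon> * \<rho>"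
        using \<epsilon> s by (intro mult_left_mono) auto
      moreover have "M * exp (- \<kappa> * (s - T)) \<ge> 0" using \<open>M \<ge> 0\<close> by simp
      ultimately have "E \<epsilon> s x' y' \<ge> B" using \<rho>(4) unfolding E_def by linarith
      then show ?thesis using bdd[OF s, of x' y'] posmax unfolding w_def by linarith
    qed
    have "a \<noteq> T"
    proof
      assume "a = T"
      have "w \<epsilon> T b c \<le> - \<epsilon> * (b\<^sup>2 + c\<^sup>2 + 1)"
        using init[of b c] by (simp add: w_def E_def)
      also have "\<dots> \<le> 0" using \<epsilon> by (simp add: mult_nonneg_nonneg)
      finally show False using posmax \<open>a = T\<close> by simp
    qed
    then have "T < a" using ab by simp
    note du = classical_entire_solutionD[OF u] and dv = classical_entire_solutionD[OF v]
    have "D_t u a b c - D_t v a b c - (- \<kappa> * (M * exp (- \<kappa> * (a - T))) + 5 * \<epsilon>)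
        \<ge> (D_x (D_x u) a b c - D_x (D_x v) a b c - 2 * \<epsilon>)
          + (D_y (D_y u) a b c - D_y (D_y v) a b c - 2 * \<epsilon>)"
    proof (rule parabolic_inequality_at_max[where w = "w \<epsilon>" and x = b and y = c and t = a
          and wx = "\<lambda>s. D_x u a s c - D_x v a s c - 2 * \<epsilon> * s"
          and wy = "\<lambda>s. D_y u a b s - D_y v a b s - 2 * \<epsilon> * s"])
      show "\<forall>\<^sub>F s in at_left a. w \<epsilon> s b c \<le> w \<epsilon> a b c"
        unfolding eventually_at_left_field using \<open>T < a\<close> ab max by (intro exI[of _ T]) auto
    qed (use max ab in \<open>auto simp: w_def E_def intro!: derivative_eq_intros du dv\<close>)
    moreover have "D_t u a b c - (D_x (D_x u) a b c + D_y (D_y u) a b c)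
        = f b c (u a b c)" "D_t v a b c - (D_x (D_x v) a b c + D_y (D_y v) a b c)
        = f b c (v a b c)" by (rule du dv)+
    ultimately have "f b c (u a b c) - f b c (v a b c) + \<kappa> * (M * exp (- \<kappa> * (a - T))) \<ge> \<epsilon>"
      by linarith
    moreover have gt: "u a b c - v a b c \<ge> M * exp (- \<kappa> * (a - T))"
    proof -
      have "\<epsilon> * (b\<^sup>2 + c\<^sup>2 + 1 + 5 * (a - T)) \<ge> 0" using \<epsilon> ab by (intro mult_nonneg_nonneg) auto
      then show ?thesis using posmax unfolding w_def E_def by linarith
    qed
    moreover have "v a b c < u a b c"
    proof -
      have "\<epsilon> * (b\<^sup>2 + c\<^sup>2 + 1 + 5 * (a - T)) \<ge> 0" using \<epsilon> ab by (intro mult_nonneg_nonneg) auto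
      moreover have "M * exp (- \<kappa> * (a - T)) \<ge> 0" using \<open>M \<ge> 0\<close> by simp
      ultimately show ?thesis using posmax unfolding w_def E_def by linarith
    qed
    moreover have "\<kappa> * (u a b c - v a b c) \<ge> \<kappa> * (M * exp (- \<kappa> * (a - T)))"
      using gt \<open>\<kappa> > 0\<close> by (intro mult_left_mono) auto
    ultimately show False using damp[OF ab, of b c] \<epsilon> by linarith
  qed
  define A where "A = x\<^sup>2 + y\<^sup>2 + 1 + 5 * (t - T)"
  have "A > 0" using \<open>T \<le> t\<close> unfolding A_def by (smt (verit) zero_le_power2)
  show ?thesis
  proof (rule field_le_epsilon)
    fix e :: real assume "e > 0"
    then have "w (e / A) t x y \<le> 0" using main \<open>A > 0\<close> by simp
    then show "u t x y - v t x y \<le> M * exp (- \<kappa> * (t - T)) + e"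
      using \<open>A > 0\<close> unfolding w_def E_def A_def[symmetric] by simp
  qed
qed

text \<open>
  A lower bound for the barrier of \<open>positivity_spreads\<close> at the end of the unit time
  interval, at distance at most \<open>D / sqrt 2\<close> from the centre.
\<close>

definition spread_bound :: "real \<Rightarrow> real \<Rightarrow> real" where
  "spread_bound K D =
     exp (- ((2 * (D\<^sup>2 - 1) + 16)\<^sup>2 / 32 + 1 + K)) * (D\<^sup>2 / 2)\<^sup>2 / 4"

lemma spread_bound_pos: "D \<ge> 1 \<Longrightarrow> spread_bound K D > 0"
  by (simp add: spread_bound_def)

text \<open>
  A quantitative strong maximum principle for the difference of two solutions: being large
  on a unit ball and almost nonnegative on the ball of radius \<open>D\<close> for one unit of time
  forces a definite positivity within radius \<open>D / sqrt 2\<close>, up to a multiple of the defect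
  \<open>\<delta>\<close>. The barrier is \<open>exp (- B (t - T)) P\<^sup>2 / 4\<close>, where \<open>P = g t - \<bar>(x, y) - (p, q)\<bar>\<^sup>2\<close>
  and \<open>g\<close> grows linearly from \<open>1\<close> to \<open>D\<^sup>2\<close>. Its support is a ball that expands from radius
  1 to radius \<open>D\<close>. With \<open>r\<^sup>2 = g - P\<close>, \<open>(\<partial>\<^sub>t - \<Delta>) P\<^sup>2 = 2 P g' + 8 P - 8 r\<^sup>2 = (2 g' + 16)
  P - 8 g\<close>, which is negative at the edge; elsewhere the factor \<open>exp (- B (t - T))\<close>
  dominates once \<open>B\<close> is large. The term \<open>\<delta> exp (K (t - T))\<close> absorbs that defect.
\<close>

lemma positivity_spreads:
  fixes u v :: "real \<Rightarrow> real \<Rightarrow> real \<Rightarrow> real"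
  assumes v: "classical_entire_solution f v" and u: "classical_entire_solution f u"
    and lip: "\<And>x y r s. \<bar>f x y r - f x y s\<bar> \<le> K * \<bar>r - s\<bar>"
    and D: "D \<ge> 1" and \<delta>: "\<delta> \<ge> 0"
    and low: "\<And>t x y. T \<le> t \<Longrightarrow> t \<le> T + 1 \<Longrightarrow> (x - p)\<^sup>2 + (y - q)\<^sup>2 \<le> D\<^sup>2 \<Longrightarrow>
      v t x y - u t x y \<ge> - \<delta>"
    and init: "\<And>x y. (x - p)\<^sup>2 + (y - q)\<^sup>2 \<le> 1 \<Longrightarrow> v T x y - u T x y \<ge> 1/4"
    and xy: "(x - p)\<^sup>2 + (y - q)\<^sup>2 \<le> D\<^sup>2 / 2"
  shows "v (T + 1) x y - u (T + 1) x y \<ge> spread_bound K D - exp K * \<delta>"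
proof -
  have K: "K \<ge> 0" using lip[of 0 0 1 0] by simp
  define g where "g t = 1 + (D\<^sup>2 - 1) * (t - T)" for t
  have D2: "D\<^sup>2 \<ge> 1" using D by simp
  define G where "G = 2 * (D\<^sup>2 - 1) + 16"
  define B where "B = G\<^sup>2 / 32 + 1 + K"
  define P where "P t x y = g t - ((x - p)\<^sup>2 + (y - q)\<^sup>2)" for t x y
  define b where "b t x y = exp (- B * (t - T)) * (P t x y)\<^sup>2 / 4 - \<delta> * exp (K * (t - T))"
    for t x y
  define w where "w t x y = b t x y - (v t x y - u t x y)" for t x y
  define E where "E = {(t, x, y). T \<le> t \<and> t \<le> T + 1 \<and> P t x y \<ge> 0}"
  have gD: "1 \<le> g t" "g t \<le> D\<^sup>2" if "T \<le> t" "t \<le> T + 1" for t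
    using that D2 mult_left_mono[of "t - T" 1 "D\<^sup>2 - 1"] by (auto simp: g_def)
  have contP: "continuous_on S (\<lambda>z. P (fst z) (fst (snd z)) (snd (snd z)))" for S
    unfolding P_def g_def by (intro continuous_intros)
  have "closed E"
  proof -
    have "E = {z. T \<le> fst z} \<inter> {z. fst z \<le> T + 1} \<inter> {z. 0 \<le> P (fst z) (fst (snd z)) (snd (snd z))}"
      by (auto simp: E_def)
    then show ?thesis
      by (simp add: closed_Int closed_Collect_le contP continuous_intros)
  qed
  moreover have "E \<subseteq> {T..T+1} \<times> {p - D..p + D} \<times> {q - D..q + D}"
  proof
    fix z assume "z \<in> E"
    obtain t x y where z: "z = (t, x, y)" by (cases z) auto
    have t: "T \<le> t" "t \<le> T + 1" and "P t x y \<ge> 0"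
      using \<open>z \<in> E\<close> by (auto simp: E_def z)
    then have "(x - p)\<^sup>2 + (y - q)\<^sup>2 \<le> D\<^sup>2" using gD[OF t] by (simp add: P_def)
    then have "(x - p)\<^sup>2 \<le> D\<^sup>2" "(y - q)\<^sup>2 \<le> D\<^sup>2"
      using zero_le_power2[of "x - p"] zero_le_power2[of "y - q"] by linarith+
    then have "\<bar>x - p\<bar> \<le> D" "\<bar>y - q\<bar> \<le> D" using D by (auto simp: abs_le_square_iff[symmetric])
    then show "z \<in> {T..T+1} \<times> {p - D..p + D} \<times> {q - D..q + D}"
      using t by (auto simp: z abs_le_iff)
  qed
  moreover have "compact ({T..T+1} \<times> {p - D..p + D} \<times> {q - D..q + D})"
    by (intro compact_Times) auto
  ultimately have "compact E" by (metis compact_Int_closed inf.absorb2)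
  have contw: "continuous_on E (\<lambda>(t, x, y). w t x y)"
    using continuous_on_subset[OF classical_entire_solutionD(7)[OF u], of E]
      continuous_on_subset[OF classical_entire_solutionD(7)[OF v], of E]
    unfolding w_def b_def split_def by (auto intro!: continuous_intros contP)
  have le: "w t x y \<le> 0" if mem: "(t, x, y) \<in> E" for t x y
  proof (rule ccontr)
    assume pos: "\<not> w t x y \<le> 0"
    obtain z where z: "z \<in> E"
      "\<And>z'. z' \<in> E \<Longrightarrow> (\<lambda>(t, x, y). w t x y) z' \<le> (\<lambda>(t, x, y). w t x y) z"
      using continuous_attains_sup[OF \<open>compact E\<close> _ contw] mem by blast
    obtain a \<xi> \<eta> where abc: "z = (a, \<xi>, \<eta>)" by (cases z) auto
    have a: "T \<le> a" "a \<le> T + 1" and P0: "P a \<xi> \<eta> \<ge> 0" using z by (auto simp: E_def abc)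
    have max: "w s x' y' \<le> w a \<xi> \<eta>" if "T \<le> s" "s \<le> T + 1" "P s x' y' \<ge> 0" for s x' y'
      using z(2)[of "(s, x', y')"] that by (simp add: abc E_def)
    have posmax: "w a \<xi> \<eta> > 0" using max[of t x y] mem pos by (auto simp: E_def)
    have dist: "(\<xi> - p)\<^sup>2 + (\<eta> - q)\<^sup>2 \<le> D\<^sup>2" using P0 gD[OF a] by (simp add: P_def)
    have e1: "exp (K * (a - T)) \<ge> 1" using K a by simp
    then have de: "\<delta> * exp (K * (a - T)) \<ge> \<delta>" using \<delta> by (simp add: mult_le_cancel_left1)
    \<comment> \<open>the maximum is neither on the lateral boundary nor at the initial time\<close>
    have "P a \<xi> \<eta> \<noteq> 0"
    proof
      assume "P a \<xi> \<eta> = 0"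
      then have "b a \<xi> \<eta> \<le> - \<delta>" using de by (simp add: b_def)
      then show False using low[OF a dist] posmax by (simp add: w_def)
    qed
    then have Ppos: "P a \<xi> \<eta> > 0" using P0 by simp
    have "a \<noteq> T"
    proof
      assume aT: "a = T"
      then have r1: "(\<xi> - p)\<^sup>2 + (\<eta> - q)\<^sup>2 \<le> 1" using P0 by (simp add: P_def g_def)
      have "P a \<xi> \<eta> \<le> 1" using aT by (simp add: P_def g_def)
      then have "(P a \<xi> \<eta>)\<^sup>2 \<le> 1" using P0 by (simp add: power_le_one)
      then have "b a \<xi> \<eta> \<le> 1/4" using \<delta> aT by (simp add: b_def)
      then show False using init[OF r1] posmax aT by (simp add: w_def)
    qed
    then have "T < a" using a by simp
    note du = classical_entire_solutionD[OF u] and dv = classical_entire_solutionD[OF v]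
    define m where "m = exp (- B * (a - T)) / 4"
    define Pa where "Pa = P a \<xi> \<eta>"
    have "(m * (- B * Pa\<^sup>2 + 2 * Pa * (D\<^sup>2 - 1)) - \<delta> * (K * exp (K * (a - T))))
           - (D_t v a \<xi> \<eta> - D_t u a \<xi> \<eta>)
        \<ge> (m * (8 * (\<xi> - p)\<^sup>2 - 4 * Pa) - (D_x (D_x v) a \<xi> \<eta> - D_x (D_x u) a \<xi> \<eta>))
          + (m * (8 * (\<eta> - q)\<^sup>2 - 4 * Pa) - (D_y (D_y v) a \<xi> \<eta> - D_y (D_y u) a \<xi> \<eta>))"
    proof (rule parabolic_inequality_at_max[where w = w and x = \<xi> and y = \<eta> and t = a
          and wx = "\<lambda>s. m * (- 4 * (s - p) * P a s \<eta>) - (D_x v a s \<eta> - D_x u a s \<eta>)"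
          and wy = "\<lambda>s. m * (- 4 * (s - q) * P a \<xi> s) - (D_y v a \<xi> s - D_y u a \<xi> s)"])
      have "((\<lambda>s. P s \<xi> \<eta>) \<longlongrightarrow> P a \<xi> \<eta>) (at_left a)"
        unfolding P_def g_def by (intro tendsto_intros)
      from order_tendstoD(1)[OF this Ppos]
      have "\<forall>\<^sub>F s in at_left a. P s \<xi> \<eta> > 0" .
      moreover have "\<forall>\<^sub>F s in at_left a. T < s \<and> s < a"
        unfolding eventually_at_left_field using \<open>T < a\<close> by blast
      ultimately show "\<forall>\<^sub>F s in at_left a. w s \<xi> \<eta> \<le> w a \<xi> \<eta>"
        by eventually_elim (use a max in auto)
      have "((\<lambda>s. P a s \<eta>) \<longlongrightarrow> P a \<xi> \<eta>) (at \<xi>)"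
        unfolding P_def g_def by (intro tendsto_intros)
      from order_tendstoD(1)[OF this Ppos]
      show "\<forall>\<^sub>F s in at \<xi>. w a s \<eta> \<le> w a \<xi> \<eta>"
        by eventually_elim (use a max in auto)
      have "((\<lambda>s. P a \<xi> s) \<longlongrightarrow> P a \<xi> \<eta>) (at \<eta>)"
        unfolding P_def g_def by (intro tendsto_intros)
      from order_tendstoD(1)[OF this Ppos]
      show "\<forall>\<^sub>F s in at \<eta>. w a \<xi> s \<le> w a \<xi> \<eta>"
        by eventually_elim (use a max in auto)
    qed (auto simp: w_def b_def P_def g_def m_def Pa_def power2_eq_square
        intro!: derivative_eq_intros du dv, auto simp: field_simps)
    moreover have "D_t u a \<xi> \<eta> - (D_x (D_x u) a \<xi> \<eta> + D_y (D_y u) a \<xi> \<eta>)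
        = f \<xi> \<eta> (u a \<xi> \<eta>)" "D_t v a \<xi> \<eta> - (D_x (D_x v) a \<xi> \<eta> + D_y (D_y v) a \<xi> \<eta>)
        = f \<xi> \<eta> (v a \<xi> \<eta>)" by (rule du dv)+
    ultimately have ineq: "m * (- B * Pa\<^sup>2 + 2 * Pa * (D\<^sup>2 - 1)) - \<delta> * (K * exp (K * (a - T)))
        - (f \<xi> \<eta> (v a \<xi> \<eta>) - f \<xi> \<eta> (u a \<xi> \<eta>))
        \<ge> m * (8 * (\<xi> - p)\<^sup>2 - 4 * Pa) + m * (8 * (\<eta> - q)\<^sup>2 - 4 * Pa)" by linarith
    have m: "m > 0" by (simp add: m_def)
    have "\<bar>v a \<xi> \<eta> - u a \<xi> \<eta>\<bar> \<le> \<delta> + m * Pa\<^sup>2"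
    proof -
      have "v a \<xi> \<eta> - u a \<xi> \<eta> \<ge> - \<delta>" by (rule low[OF a dist])
      moreover have "v a \<xi> \<eta> - u a \<xi> \<eta> \<le> m * Pa\<^sup>2 - \<delta>"
        using posmax de by (simp add: w_def b_def m_def Pa_def)
      moreover have "m * Pa\<^sup>2 \<ge> 0" using m by simp
      ultimately show ?thesis using \<delta> by linarith
    qed
    then have "K * \<bar>v a \<xi> \<eta> - u a \<xi> \<eta>\<bar> \<le> K * (\<delta> + m * Pa\<^sup>2)"
      using K by (rule mult_left_mono)
    then have "- (f \<xi> \<eta> (v a \<xi> \<eta>) - f \<xi> \<eta> (u a \<xi> \<eta>)) \<le> K * (\<delta> + m * Pa\<^sup>2)"
      using lip[of \<xi> \<eta> "v a \<xi> \<eta>" "u a \<xi> \<eta>"] by linarith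
    moreover have "\<delta> * (K * exp (K * (a - T))) \<ge> K * \<delta>"
      using mult_left_mono[OF de K] by (simp add: mult_ac)
    ultimately have "m * (- B * Pa\<^sup>2 + 2 * Pa * (D\<^sup>2 - 1)) + K * (m * Pa\<^sup>2)
        \<ge> m * (8 * (\<xi> - p)\<^sup>2 - 4 * Pa) + m * (8 * (\<eta> - q)\<^sup>2 - 4 * Pa)"
      using ineq by (simp add: distrib_left)
    then have "m * ((- B + K) * Pa\<^sup>2 + 2 * Pa * (D\<^sup>2 - 1)
        - 8 * ((\<xi> - p)\<^sup>2 + (\<eta> - q)\<^sup>2) + 8 * Pa) \<ge> 0"
      by (simp add: algebra_simps)
    then have "(- B + K) * Pa\<^sup>2 + 2 * Pa * (D\<^sup>2 - 1)
        - 8 * ((\<xi> - p)\<^sup>2 + (\<eta> - q)\<^sup>2) + 8 * Pa \<ge> 0"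
      using m by (simp add: zero_le_mult_iff)
    moreover have "(\<xi> - p)\<^sup>2 + (\<eta> - q)\<^sup>2 = g a - Pa" by (simp add: Pa_def P_def)
    ultimately have neg: "- (G\<^sup>2 / 32 + 1) * Pa\<^sup>2 + Pa * G - 8 * g a \<ge> 0"
      by (simp add: B_def G_def algebra_simps)
    \<comment> \<open>the choice of \<open>B\<close> completes the square\<close>
    define S where "S = (G * Pa - 16)\<^sup>2 / 32"
    have square: "- (G\<^sup>2 / 32 + 1) * Pa\<^sup>2 + Pa * G - 8 * g a
        = - S - Pa\<^sup>2 - 8 * (g a - 1)"
      by (simp add: S_def power2_eq_square field_simps)
    have "Pa\<^sup>2 > 0" "S \<ge> 0" using Ppos by (simp_all add: Pa_def S_def)
    then show False using neg[unfolded square] gD(1)[OF a] by argo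
  qed
  have g1: "g (T + 1) = D\<^sup>2" by (simp add: g_def)
  have P1: "P (T + 1) x y \<ge> D\<^sup>2 / 2" using xy unfolding P_def g1 by argo
  have "0 \<le> D\<^sup>2 / 2" by simp
  then have "0 \<le> P (T + 1) x y" using P1 by (rule order_trans)
  then have "w (T + 1) x y \<le> 0" by (intro le) (simp add: E_def)
  moreover have "exp (- B) * (P (T + 1) x y)\<^sup>2 / 4 \<ge> spread_bound K D"
    unfolding spread_bound_def B_def G_def
    by (intro divide_right_mono mult_left_mono power_mono P1) auto
  ultimately show ?thesis by (simp add: w_def b_def mult.commute)
qed

section \<open>Pulsating fronts\<close>

lemma front_limits:
  assumes "pulsating_front L1 L2 f e U c" and "\<epsilon> > 0"
  obtains M where "M > 0" "\<And>\<xi> x y. \<xi> \<ge> M \<Longrightarrow> \<bar>U \<xi> x y\<bar> \<le> \<epsilon>"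
    "\<And>\<xi> x y. \<xi> \<le> - M \<Longrightarrow> \<bar>U \<xi> x y - 1\<bar> \<le> \<epsilon>"
proof -
  have top: "uniform_limit UNIV (\<lambda>\<xi> (x, y). U \<xi> x y) (\<lambda>_. 0) at_top"
    and bot: "uniform_limit UNIV (\<lambda>\<xi> (x, y). U \<xi> x y) (\<lambda>_. 1) at_bot"
    using assms(1) by (simp_all add: pulsating_front_def)
  obtain M1 where M1: "\<And>\<xi> x y. \<xi> \<ge> M1 \<Longrightarrow> \<bar>U \<xi> x y\<bar> < \<epsilon>"
    using uniform_limitD[OF top \<open>\<epsilon> > 0\<close>]
    unfolding eventually_at_top_linorder by (auto simp: dist_real_def)
  obtain M2 where M2: "\<And>\<xi> x y. \<xi> \<le> M2 \<Longrightarrow> \<bar>U \<xi> x y - 1\<bar> < \<epsilon>"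
    using uniform_limitD[OF bot \<open>\<epsilon> > 0\<close>]
    unfolding eventually_at_bot_linorder by (auto simp: dist_real_def)
  show thesis
  proof (rule that[of "max 1 (max M1 (- M2))"])
    show "\<bar>U \<xi> x y\<bar> \<le> \<epsilon>" if "\<xi> \<ge> max 1 (max M1 (- M2))" for \<xi> x y
      using M1[of \<xi> x y] that by auto
    show "\<bar>U \<xi> x y - 1\<bar> \<le> \<epsilon>" if "\<xi> \<le> - max 1 (max M1 (- M2))" for \<xi> x y
    proof -
      have "\<xi> \<le> M2" using that by linarith
      then show ?thesis using M2[of \<xi> x y] by linarith
    qed
  qed simp
qed

lemma front_reduce_to_cell:
  assumes U: "pulsating_front L1 L2 f e U c" and L: "L1 > 0" "L2 > 0"
  obtains x' y' where "x' \<in> {0..L1}" "y' \<in> {0..L2}" "\<And>\<xi>. U \<xi> x y = U \<xi> x' y'"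
proof -
  define k1 where "k1 = \<lfloor>x / L1\<rfloor>"
  define k2 where "k2 = \<lfloor>y / L2\<rfloor>"
  have "of_int k1 \<le> x / L1" "x / L1 \<le> of_int k1 + 1"
    "of_int k2 \<le> y / L2" "y / L2 \<le> of_int k2 + 1"
    unfolding k1_def k2_def by linarith+
  then have "of_int k1 * L1 \<le> x" "x \<le> (of_int k1 + 1) * L1"
    "of_int k2 * L2 \<le> y" "y \<le> (of_int k2 + 1) * L2"
    using L by (simp_all add: pos_le_divide_eq pos_divide_le_eq)
  moreover have "U \<xi> (x - of_int k1 * L1) (y - of_int k2 * L2) = U \<xi> x y" for \<xi>
    using U unfolding pulsating_front_def
    by (metis (no_types, opaque_lifting) diff_add_cancel)
  ultimately show thesis
    by (intro that[of "x - of_int k1 * L1" "y - of_int k2 * L2"]) (auto simp: algebra_simps)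
qed

text \<open>
  The solution \<open>u t x y = U ((x, y) \<bullet> e - c * t) x y\<close> is continuous, and for \<open>c \<noteq> 0\<close> the
  profile is recovered from it by solving \<open>\<xi> = (x, y) \<bullet> e - c * t\<close> for \<open>t\<close>.
\<close>

lemma front_continuous:
  assumes U: "pulsating_front L1 L2 f e U c" and c: "c \<noteq> 0"
  shows "continuous_on S (\<lambda>(\<xi>, x, y). U \<xi> x y)"
proof -
  define u where "u = (\<lambda>t x y. U ((x, y) \<bullet> e - c * t) x y)"
  have "classical_entire_solution f u"
    using U by (simp add: pulsating_front_def u_def)
  then have "continuous_on UNIV (\<lambda>(t, x, y). u t x y)"
    by (rule classical_entire_solutionD)
  then have "continuous_on UNIV (\<lambda>p::real \<times> real \<times> real.
      (\<lambda>(t, x, y). u t x y) ((snd p \<bullet> e - fst p) / c, fst (snd p), snd (snd p)))"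
    by (rule continuous_on_compose2) (use c in \<open>auto intro!: continuous_intros\<close>)
  moreover have "(\<lambda>(t, x, y). u t x y) ((snd p \<bullet> e - fst p) / c, fst (snd p), snd (snd p))
      = (\<lambda>(\<xi>, x, y). U \<xi> x y) p" for p
    using c by (simp add: u_def split_def)
  ultimately show ?thesis using continuous_on_subset by (metis (no_types, lifting) continuous_on_cong subset_UNIV)
qed

lemma front_bounded:
  assumes U: "pulsating_front L1 L2 f e U c" and c: "c \<noteq> 0" and L: "L1 > 0" "L2 > 0"
  obtains B where "\<And>\<xi> x y. \<bar>U \<xi> x y\<bar> \<le> B"
proof -
  obtain M where M: "M > 0" "\<And>\<xi> x y. \<xi> \<ge> M \<Longrightarrow> \<bar>U \<xi> x y\<bar> \<le> 1"
    "\<And>\<xi> x y. \<xi> \<le> - M \<Longrightarrow> \<bar>U \<xi> x y - 1\<bar> \<le> 1"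
    using front_limits[OF U, of 1] by auto
  define Q where "Q = {-M..M} \<times> {0..L1} \<times> {0..L2}"
  have "compact ((\<lambda>(\<xi>, x, y). U \<xi> x y) ` Q)"
    unfolding Q_def by (intro compact_continuous_image front_continuous[OF U c] compact_Times) auto
  then obtain B where B: "\<And>z. z \<in> (\<lambda>(\<xi>, x, y). U \<xi> x y) ` Q \<Longrightarrow> \<bar>z\<bar> \<le> B"
    using compact_imp_bounded bounded_real by metis
  show thesis
  proof (rule that[of "max B 2"])
    fix \<xi> x y
    obtain x' y' where xy: "x' \<in> {0..L1}" "y' \<in> {0..L2}" "\<And>\<xi>. U \<xi> x y = U \<xi> x' y'"
      using front_reduce_to_cell[OF U L] by metis
    show "\<bar>U \<xi> x y\<bar> \<le> max B 2"
    proof (cases "\<xi> \<in> {-M..M}")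
      case True
      then have "(\<xi>, x', y') \<in> Q" using xy by (simp add: Q_def)
      from B[OF imageI[OF this]] show ?thesis by (simp add: xy(3))
    next
      case False
      then show ?thesis using M(2)[of \<xi> x y] M(3)[of \<xi> x y] by auto
    qed
  qed
qed

lemma front_uniformly_continuous:
  assumes U: "pulsating_front L1 L2 f e U c" and c: "c \<noteq> 0" and L: "L1 > 0" "L2 > 0"
    and \<epsilon>: "\<epsilon> > 0"
  obtains \<eta> where "\<eta> > 0" "\<eta> \<le> 1"
    "\<And>\<xi> \<xi>' x y. \<bar>\<xi> - \<xi>'\<bar> \<le> \<eta> \<Longrightarrow> \<bar>U \<xi> x y - U \<xi>' x y\<bar> \<le> \<epsilon>"
proof -
  obtain M where M: "M > 0" "\<And>\<xi> x y. \<xi> \<ge> M \<Longrightarrow> \<bar>U \<xi> x y\<bar> \<le> \<epsilon> / 2"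
    "\<And>\<xi> x y. \<xi> \<le> - M \<Longrightarrow> \<bar>U \<xi> x y - 1\<bar> \<le> \<epsilon> / 2"
    using front_limits[OF U, of "\<epsilon> / 2"] \<epsilon> by auto
  define Q where "Q = {- M - 1..M + 1} \<times> {0..L1} \<times> {0..L2}"
  have "compact Q" unfolding Q_def by (intro compact_Times) auto
  then have "uniformly_continuous_on Q (\<lambda>(\<xi>, x, y). U \<xi> x y)"
    by (rule compact_uniformly_continuous[OF front_continuous[OF U c]])
  then obtain d where d: "d > 0" "\<And>p p'. p \<in> Q \<Longrightarrow> p' \<in> Q \<Longrightarrow> dist p' p < d \<Longrightarrow>
      dist ((\<lambda>(\<xi>, x, y). U \<xi> x y) p') ((\<lambda>(\<xi>, x, y). U \<xi> x y) p) < \<epsilon>"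
    using \<epsilon> unfolding uniformly_continuous_on_def by meson
  show thesis
  proof (rule that[of "min 1 (d / 2)"])
    fix \<xi> \<xi>' x y :: real
    assume h: "\<bar>\<xi> - \<xi>'\<bar> \<le> min 1 (d / 2)"
    obtain x' y' where xy: "x' \<in> {0..L1}" "y' \<in> {0..L2}" "\<And>\<xi>. U \<xi> x y = U \<xi> x' y'"
      using front_reduce_to_cell[OF U L] by metis
    consider "\<xi> \<ge> M" "\<xi>' \<ge> M" | "\<xi> \<le> - M" "\<xi>' \<le> - M"
      | "\<xi> \<in> {- M - 1..M + 1}" "\<xi>' \<in> {- M - 1..M + 1}"
      using h M(1) by (auto simp: abs_le_iff) linarith
    then show "\<bar>U \<xi> x y - U \<xi>' x y\<bar> \<le> \<epsilon>"
    proof cases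
      case 1
      then show ?thesis using M(2)[of \<xi> x y] M(2)[of \<xi>' x y] by linarith
    next
      case 2
      then show ?thesis using M(3)[of \<xi> x y] M(3)[of \<xi>' x y] by linarith
    next
      case 3
      then have "(\<xi>, x', y') \<in> Q" "(\<xi>', x', y') \<in> Q" using xy by (simp_all add: Q_def)
      moreover have "dist (\<xi>', x', y') (\<xi>, x', y') < d"
        using h d(1) by (auto simp: dist_Pair_Pair dist_real_def abs_minus_commute)
      ultimately show ?thesis using d(2)[of "(\<xi>, x', y')" "(\<xi>', x', y')"]
        by (simp add: xy(3) dist_real_def)
    qed
  qed (use d in auto)
qed

lemma exponential_decay:
  fixes \<kappa> \<epsilon> M :: real
  assumes "\<kappa> > 0" "\<epsilon> > 0"
  obtains S where "S \<ge> 0" "\<And>s. s \<ge> S \<Longrightarrow> M * exp (- \<kappa> * s) \<le> \<epsilon>"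
proof (rule that[of "\<bar>M\<bar> / (\<kappa> * \<epsilon>)"])
  show "\<bar>M\<bar> / (\<kappa> * \<epsilon>) \<ge> 0" using assms by simp
  fix s assume "s \<ge> \<bar>M\<bar> / (\<kappa> * \<epsilon>)"
  then have "\<bar>M\<bar> \<le> (\<kappa> * s) * \<epsilon>" using assms by (simp add: pos_divide_le_eq mult_ac)
  also have "\<dots> \<le> exp (\<kappa> * s) * \<epsilon>"
  proof (rule mult_right_mono)
    show "\<kappa> * s \<le> exp (\<kappa> * s)" using exp_ge_add_one_self[of "\<kappa> * s"] by linarith
  qed (use assms in simp)
  finally have "\<bar>M\<bar> \<le> exp (\<kappa> * s) * \<epsilon>" .
  then have "\<bar>M\<bar> * exp (- \<kappa> * s) \<le> \<epsilon>"
    by (simp add: exp_minus field_simps)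
  moreover have "M * exp (- \<kappa> * s) \<le> \<bar>M\<bar> * exp (- \<kappa> * s)"
    by (intro mult_right_mono) auto
  ultimately show "M * exp (- \<kappa> * s) \<le> \<epsilon>" by linarith
qed

lemma dampedD:
  assumes "damped f \<kappa> \<sigma>" "v < u" "u \<le> \<sigma> \<or> 1 - \<sigma> \<le> v"
  shows "f x y u - f x y v \<le> - \<kappa> * (u - v)"
  using assms unfolding damped_def by blast

text \<open>
  A negative part would be damped on all of \<open>(- \<infinity>, t]\<close>: comparing \<open>u\<close> with the solution 0
  from time \<open>t - s\<close> on bounds it by a multiple of \<open>exp (- \<kappa> * s)\<close>, for every \<open>s\<close>. Likewise
  for the part above 1.
\<close>

lemma bounded_entire_solution_range:
  assumes u: "classical_entire_solution f u" and B: "\<And>t x y. \<bar>u t x y\<bar> \<le> B"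
    and f0: "\<And>x y. f x y 0 = 0" "\<And>x y. f x y 1 = 0"
    and damped: "damped f \<kappa> \<sigma>" and \<kappa>: "\<kappa> > 0" and \<sigma>: "\<sigma> > 0"
  shows "0 \<le> u t x y" "u t x y \<le> 1"
proof -
  have B0: "B \<ge> 0" using B[of 0 0 0] by linarith
  have sol: "classical_entire_solution f (\<lambda>t x y. 0)" "classical_entire_solution f (\<lambda>t x y. 1)"
    using f0 by (auto intro: classical_entire_solution_const)
  have le: "v t x y - w t x y \<le> 0"
    if v: "classical_entire_solution f v" and w: "classical_entire_solution f w"
      and bdd: "\<And>t x y. v t x y - w t x y \<le> B + 1"
      and stable: "\<And>t x y. v t x y \<le> \<sigma> \<or> 1 - \<sigma> \<le> w t x y" for v w
  proof (rule field_le_epsilon)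
    fix \<epsilon> :: real assume "\<epsilon> > 0"
    then obtain s where s: "s \<ge> 0" "(B + 1) * exp (- \<kappa> * s) \<le> \<epsilon>"
      using exponential_decay[OF \<kappa>, of \<epsilon> "B + 1"] by blast
    have "v t x y - w t x y \<le> (B + 1) * exp (- \<kappa> * (t - (t - s)))"
    proof (rule comparison_damped[OF v w \<kappa>, where B = "B + 1" and T' = t])
      show "f x y (v t' x y) - f x y (w t' x y) \<le> - \<kappa> * (v t' x y - w t' x y)"
        if "w t' x y < v t' x y" for t' x y
        using dampedD[OF damped that stable] .
    qed (use s B0 bdd in simp_all)
    then show "v t x y - w t x y \<le> 0 + \<epsilon>" using s by simp
  qed
  have "0 - u t x y \<le> B + 1" "u t x y - 1 \<le> B + 1" for t x y
    using B[of t x y] by linarith+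
  then show "0 \<le> u t x y" "u t x y \<le> 1"
    using le[OF sol(1) u] le[OF u sol(2)] \<sigma> by simp_all
qed

section \<open>The motion of the corner\<close>

lemma projection_square_le:
  fixes x y \<theta> :: real
  shows "(x * cos \<theta> + y * sin \<theta>)\<^sup>2 \<le> x\<^sup>2 + y\<^sup>2"
proof -
  have "(x * cos \<theta> + y * sin \<theta>)\<^sup>2 + (x * sin \<theta> - y * cos \<theta>)\<^sup>2
      = (x\<^sup>2 + y\<^sup>2) * ((sin \<theta>)\<^sup>2 + (cos \<theta>)\<^sup>2)"
    by algebra
  then have "(x * cos \<theta> + y * sin \<theta>)\<^sup>2 + (x * sin \<theta> - y * cos \<theta>)\<^sup>2 = x\<^sup>2 + y\<^sup>2"
    by simp
  then show ?thesis using zero_le_power2[of "x * sin \<theta> - y * cos \<theta>"] by linarith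
qed

lemma projection_le:
  fixes x y \<theta> :: real
  assumes "x\<^sup>2 + y\<^sup>2 \<le> r\<^sup>2" "r \<ge> 0"
  shows "\<bar>x * cos \<theta> + y * sin \<theta>\<bar> \<le> r"
  using order_trans[OF projection_square_le assms(1)] assms(2)
  by (simp add: abs_le_square_iff[symmetric])

lemma square_less_sum_squares:
  fixes x y R :: real
  assumes "\<bar>R\<bar> < \<bar>x\<bar> \<or> \<bar>R\<bar> < \<bar>y\<bar>"
  shows "R\<^sup>2 < x\<^sup>2 + y\<^sup>2"
proof -
  have "R\<^sup>2 < x\<^sup>2 \<or> R\<^sup>2 < y\<^sup>2"
    using assms power_strict_mono[of "\<bar>R\<bar>" "\<bar>x\<bar>" 2] power_strict_mono[of "\<bar>R\<bar>" "\<bar>y\<bar>" 2] by auto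
  then show ?thesis using zero_le_power2[of x] zero_le_power2[of y] by linarith
qed

lemma front_entire_solution:
  assumes "pulsating_front L1 L2 f (dir \<theta>) U c"
  shows "classical_entire_solution f (\<lambda>t x y. U (x * cos \<theta> + y * sin \<theta> - c * t) x y)"
  using assms by (simp add: pulsating_front_def dir_def)

text \<open>
  The solution of the linear system for the point with prescribed projections onto \<open>dir \<alpha>\<close>
  and \<open>dir \<beta>\<close>; the same formula gives points of the plane and the velocity of the corner.
\<close>

lemma corner_coordinates:
  fixes \<alpha> \<beta> p q :: real
  assumes s: "sin (\<beta> - \<alpha>) > 0"
    and x: "x = (p * sin \<beta> - q * sin \<alpha>) / sin (\<beta> - \<alpha>)"
    and y: "y = (q * cos \<alpha> - p * cos \<beta>) / sin (\<beta> - \<alpha>)"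
  shows "x * cos \<alpha> + y * sin \<alpha> = p" "x * cos \<beta> + y * sin \<beta> = q"
proof -
  have sd: "sin (\<beta> - \<alpha>) = sin \<beta> * cos \<alpha> - cos \<beta> * sin \<alpha>" by (simp add: sin_diff)
  have "x * cos \<alpha> + y * sin \<alpha> = p * sin (\<beta> - \<alpha>) / sin (\<beta> - \<alpha>)"
    unfolding x y sd by (simp add: add_divide_distrib[symmetric] algebra_simps)
  then show "x * cos \<alpha> + y * sin \<alpha> = p" using s by simp
  have "x * cos \<beta> + y * sin \<beta> = q * sin (\<beta> - \<alpha>) / sin (\<beta> - \<alpha>)"
    unfolding x y sd by (simp add: add_divide_distrib[symmetric] algebra_simps)
  then show "x * cos \<beta> + y * sin \<beta> = q" using s by simp
qed

text \<open>
  If the corner did not stay at bounded distance from \<open>(0, c * t)\<close>, then at a late time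
  \<open>T\<close> the solution \<open>V\<close> would be \<open>\<delta>\<close>-close to the maximum of the two fronts in a large disc
  around the corner. Relative to the corner, \<open>(q1, q2)\<close> lies where \<open>U\<^sub>\<alpha>\<close> is near 0 and
  \<open>U\<^sub>\<beta>\<close> near 1, and \<open>(e1, e2)\<close> where it is the other way round. So \<open>V - U\<^sub>\<alpha>\<close> is at least
  \<open>1/4\<close> near the former at time \<open>T\<close> and at most \<open>\<delta>\<close> at the latter at time \<open>T + 1\<close>. The
  distance of the two points does not depend on \<open>T\<close>, and neither does the lower bound that
  \<open>positivity_spreads\<close> gives for \<open>V - U\<^sub>\<alpha>\<close>; it exceeds \<open>\<delta>\<close> if \<open>\<delta>\<close> is small.
\<close>

lemma corner_velocity:
  fixes U\<^sub>\<alpha> U\<^sub>\<beta> :: "real \<Rightarrow> real \<Rightarrow> real \<Rightarrow> real"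
  assumes V: "classical_entire_solution f V"
    and U\<alpha>: "pulsating_front L1 L2 f (dir \<alpha>) U\<^sub>\<alpha> a" and U\<beta>: "pulsating_front L1 L2 f (dir \<beta>) U\<^sub>\<beta> b"
    and s: "sin (\<beta> - \<alpha>) > 0"
    and lip: "\<And>x y r s. \<bar>f x y r - f x y s\<bar> \<le> K * \<bar>r - s\<bar>"
    and close: "\<And>\<delta>. \<delta> > 0 \<Longrightarrow> \<exists>R. \<forall>t x y. x\<^sup>2 + (y - c * t)\<^sup>2 > R\<^sup>2 \<longrightarrow>
      \<bar>V t x y - max (U\<^sub>\<alpha> (x * cos \<alpha> + y * sin \<alpha> - a * t) x y)
                      (U\<^sub>\<beta> (x * cos \<beta> + y * sin \<beta> - b * t) x y)\<bar> \<le> \<delta>"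
  shows "a = c * sin \<alpha> \<and> b = c * sin \<beta>"
proof -
  define v1 where "v1 = (a * sin \<beta> - b * sin \<alpha>) / sin (\<beta> - \<alpha>)"
  define v2 where "v2 = (b * cos \<alpha> - a * cos \<beta>) / sin (\<beta> - \<alpha>)"
  have v: "v1 * cos \<alpha> + v2 * sin \<alpha> = a" "v1 * cos \<beta> + v2 * sin \<beta> = b"
    using corner_coordinates[OF s v1_def v2_def] .
  have "v1 = 0 \<and> v2 = c"
  proof (rule ccontr)
    assume v_ne: "\<not> (v1 = 0 \<and> v2 = c)"
    obtain M1 where M1: "M1 > 0" "\<And>\<xi> x y. \<xi> \<ge> M1 \<Longrightarrow> \<bar>U\<^sub>\<alpha> \<xi> x y\<bar> \<le> 1/8"
      "\<And>\<xi> x y. \<xi> \<le> - M1 \<Longrightarrow> \<bar>U\<^sub>\<alpha> \<xi> x y - 1\<bar> \<le> 1/8"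
      using front_limits[OF U\<alpha>, of "1/8"] by auto
    obtain M2 where M2: "M2 > 0" "\<And>\<xi> x y. \<xi> \<ge> M2 \<Longrightarrow> \<bar>U\<^sub>\<beta> \<xi> x y\<bar> \<le> 1/8"
      "\<And>\<xi> x y. \<xi> \<le> - M2 \<Longrightarrow> \<bar>U\<^sub>\<beta> \<xi> x y - 1\<bar> \<le> 1/8"
      using front_limits[OF U\<beta>, of "1/8"] by auto
    define M where "M = max M1 M2"
    have M: "M1 \<le> M" "M2 \<le> M" by (simp_all add: M_def)
    obtain q1 q2 where q: "q1 * cos \<alpha> + q2 * sin \<alpha> = M + 1" "q1 * cos \<beta> + q2 * sin \<beta> = - (M + 1)"
      using corner_coordinates[OF s refl refl] by blast
    obtain e1 e2 where e: "e1 * cos \<alpha> + e2 * sin \<alpha> = - M" "e1 * cos \<beta> + e2 * sin \<beta> = M"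
      using corner_coordinates[OF s refl refl] by blast
    define dd where "dd = (v1 + e1 - q1)\<^sup>2 + (v2 + e2 - q2)\<^sup>2"
    define D where "D = sqrt (1 + 2 * dd)"
    have dd: "dd \<ge> 0" by (simp add: dd_def)
    have D: "D \<ge> 1" "D\<^sup>2 = 1 + 2 * dd" using dd by (simp_all add: D_def)
    define E where "E = exp K + 1"
    have E: "E > 0" using exp_gt_zero[of K] by (simp add: E_def add_pos_pos)
    define \<delta> where "\<delta> = min (1/4) (spread_bound K D / (2 * E))"
    have "\<delta> > 0" using spread_bound_pos[OF D(1), of K] E by (simp add: \<delta>_def)
    moreover have "\<delta> \<le> 1/4" unfolding \<delta>_def by (rule min.cobounded1)
    ultimately have \<delta>: "\<delta> > 0" "\<delta> \<le> 1/4" .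
    have "\<delta> * E \<le> spread_bound K D / (2 * E) * E"
      using E by (intro mult_right_mono) (auto simp: \<delta>_def)
    also have "\<dots> = spread_bound K D / 2" using E by simp
    finally have "\<delta> * (exp K + 1) < spread_bound K D"
      using spread_bound_pos[OF D(1), of K] unfolding E_def by linarith
    then have \<delta>_small: "\<delta> < spread_bound K D - exp K * \<delta>" by (simp add: algebra_simps)
    obtain R where R: "\<And>t x y. x\<^sup>2 + (y - c * t)\<^sup>2 > R\<^sup>2 \<Longrightarrow>
      \<bar>V t x y - max (U\<^sub>\<alpha> (x * cos \<alpha> + y * sin \<alpha> - a * t) x y)
                      (U\<^sub>\<beta> (x * cos \<beta> + y * sin \<beta> - b * t) x y)\<bar> \<le> \<delta>"
      using close[OF \<delta>(1)] by blast
    obtain T where T: "T \<ge> 0" "T * \<bar>v1\<bar> > \<bar>R\<bar> + \<bar>q1\<bar> + D \<or>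
        T * \<bar>v2 - c\<bar> > \<bar>R\<bar> + \<bar>q2\<bar> + D + \<bar>c\<bar>"
    proof (cases "v1 = 0")
      case False
      show thesis
        by (rule that[of "(\<bar>R\<bar> + \<bar>q1\<bar> + D + 1) / \<bar>v1\<bar>"]) (use False D in auto)
    next
      case True
      then have "v2 - c \<noteq> 0" using v_ne by simp
      show thesis
        by (rule that[of "(\<bar>R\<bar> + \<bar>q2\<bar> + D + \<bar>c\<bar> + 1) / \<bar>v2 - c\<bar>"])
          (use \<open>v2 - c \<noteq> 0\<close> D in auto)
    qed
    define Q1 where "Q1 = v1 * T + q1"
    define Q2 where "Q2 = v2 * T + q2"
    have far: "x\<^sup>2 + (y - c * t)\<^sup>2 > R\<^sup>2"
      if t: "T \<le> t" "t \<le> T + 1" and xy: "(x - Q1)\<^sup>2 + (y - Q2)\<^sup>2 \<le> D\<^sup>2" for t x y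
    proof -
      have "(x - Q1)\<^sup>2 \<le> D\<^sup>2" "(y - Q2)\<^sup>2 \<le> D\<^sup>2"
        using xy zero_le_power2[of "x - Q1"] zero_le_power2[of "y - Q2"] by linarith+
      then have dist: "\<bar>x - Q1\<bar> \<le> D" "\<bar>y - Q2\<bar> \<le> D"
        using D(1) by (auto simp: abs_le_square_iff[symmetric])
      have tri: "\<bar>k - m - n\<bar> \<le> \<bar>k\<bar> + \<bar>m\<bar> + \<bar>n\<bar>" for k m n :: real
        by linarith
      have "\<bar>v1 * T\<bar> \<le> \<bar>x\<bar> + \<bar>q1\<bar> + \<bar>x - Q1\<bar>"
        using tri[of x q1 "x - Q1"] by (simp add: Q1_def)
      then have *: "T * \<bar>v1\<bar> \<le> \<bar>x\<bar> + \<bar>q1\<bar> + D"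
        using dist(1) T(1) by (simp add: abs_mult mult.commute)
      have "\<bar>c * (t - T)\<bar> \<le> \<bar>c\<bar>" using t by (simp add: abs_mult mult_left_le)
      moreover have "(v2 - c) * T = (y - c * t) - q2 - ((y - Q2) - c * (t - T))"
        by (simp add: Q2_def algebra_simps)
      moreover have "\<bar>(y - Q2) - c * (t - T)\<bar> \<le> \<bar>y - Q2\<bar> + \<bar>c * (t - T)\<bar>"
        by (rule abs_triangle_ineq4)
      ultimately have "\<bar>(v2 - c) * T\<bar> \<le> \<bar>y - c * t\<bar> + \<bar>q2\<bar> + (D + \<bar>c\<bar>)"
        using tri[of "y - c * t" q2 "(y - Q2) - c * (t - T)"] dist(2) by linarith
      then have **: "T * \<bar>v2 - c\<bar> \<le> \<bar>y - c * t\<bar> + \<bar>q2\<bar> + (D + \<bar>c\<bar>)"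
        using T(1) by (simp add: abs_mult mult.commute)
      have "\<bar>R\<bar> < \<bar>x\<bar> \<or> \<bar>R\<bar> < \<bar>y - c * t\<bar>"
        using T(2) * ** by argo
      then show ?thesis by (rule square_less_sum_squares)
    qed
    define E1 where "E1 = v1 * (T + 1) + e1"
    define E2 where "E2 = v2 * (T + 1) + e2"
    have EQ: "(E1 - Q1)\<^sup>2 + (E2 - Q2)\<^sup>2 = dd"
      by (simp add: E1_def E2_def Q1_def Q2_def dd_def algebra_simps)
    have "V (T + 1) E1 E2 - U\<^sub>\<alpha> (E1 * cos \<alpha> + E2 * sin \<alpha> - a * (T + 1)) E1 E2
        \<ge> spread_bound K D - exp K * \<delta>"
    proof (rule positivity_spreads[OF V front_entire_solution[OF U\<alpha>] lip D(1), where p = Q1 and q = Q2])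
      fix t x y assume "T \<le> t" "t \<le> T + 1" "(x - Q1)\<^sup>2 + (y - Q2)\<^sup>2 \<le> D\<^sup>2"
      from R[OF far[OF this]]
      show "- \<delta> \<le> V t x y - U\<^sub>\<alpha> (x * cos \<alpha> + y * sin \<alpha> - a * t) x y" by linarith
    next
      fix x y assume xy: "(x - Q1)\<^sup>2 + (y - Q2)\<^sup>2 \<le> 1"
      have "\<bar>(x - Q1) * cos \<phi> + (y - Q2) * sin \<phi>\<bar> \<le> 1" for \<phi>
        using xy by (intro projection_le) auto
      note proj = this[of \<alpha>] this[of \<beta>]
      have "x * cos \<alpha> + y * sin \<alpha> - a * T = (x - Q1) * cos \<alpha> + (y - Q2) * sin \<alpha> + (M + 1)"
        unfolding q(1)[symmetric] v(1)[symmetric] by (simp add: Q1_def Q2_def algebra_simps)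
      then have "x * cos \<alpha> + y * sin \<alpha> - a * T \<ge> M1" using proj(1) M by linarith
      from M1(2)[OF this, of x y]
      have "U\<^sub>\<alpha> (x * cos \<alpha> + y * sin \<alpha> - a * T) x y \<le> 1/8" by linarith
      moreover have "x * cos \<beta> + y * sin \<beta> - b * T
          = (x - Q1) * cos \<beta> + (y - Q2) * sin \<beta> + - (M + 1)"
        unfolding q(2)[symmetric] v(2)[symmetric] by (simp add: Q1_def Q2_def algebra_simps)
      then have "x * cos \<beta> + y * sin \<beta> - b * T \<le> - M2" using proj(2) M by linarith
      from M2(3)[OF this, of x y]
      have "U\<^sub>\<beta> (x * cos \<beta> + y * sin \<beta> - b * T) x y \<ge> 7/8" by linarith
      moreover have "R\<^sup>2 < x\<^sup>2 + (y - c * T)\<^sup>2"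
        by (rule far) (use xy D dd in auto)
      ultimately show "1/4 \<le> V T x y - U\<^sub>\<alpha> (x * cos \<alpha> + y * sin \<alpha> - a * T) x y"
        using R[of x y T] \<delta> by linarith
    next
      show "(E1 - Q1)\<^sup>2 + (E2 - Q2)\<^sup>2 \<le> D\<^sup>2 / 2" unfolding EQ D by simp
    qed (use \<delta> in auto)
    moreover have "V (T + 1) E1 E2 - U\<^sub>\<alpha> (E1 * cos \<alpha> + E2 * sin \<alpha> - a * (T + 1)) E1 E2 \<le> \<delta>"
    proof -
      have "E1 * cos \<alpha> + E2 * sin \<alpha> - a * (T + 1) = - M"
        unfolding e(1)[symmetric] v(1)[symmetric] by (simp add: E1_def E2_def algebra_simps)
      then have "E1 * cos \<alpha> + E2 * sin \<alpha> - a * (T + 1) \<le> - M1" using M by linarith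
      from M1(3)[OF this, of E1 E2]
      have "U\<^sub>\<alpha> (E1 * cos \<alpha> + E2 * sin \<alpha> - a * (T + 1)) E1 E2 \<ge> 7/8" by linarith
      moreover have "E1 * cos \<beta> + E2 * sin \<beta> - b * (T + 1) = M"
        unfolding e(2)[symmetric] v(2)[symmetric] by (simp add: E1_def E2_def algebra_simps)
      then have "E1 * cos \<beta> + E2 * sin \<beta> - b * (T + 1) \<ge> M2" using M by linarith
      from M2(2)[OF this, of E1 E2]
      have "U\<^sub>\<beta> (E1 * cos \<beta> + E2 * sin \<beta> - b * (T + 1)) E1 E2 \<le> 1/8" by linarith
      moreover have "R\<^sup>2 < E1\<^sup>2 + (E2 - c * (T + 1))\<^sup>2"
        by (rule far) (use EQ D dd in auto)
      ultimately show ?thesis using R[of E1 E2 "T + 1"] by linarith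
    qed
    ultimately show False using \<delta>_small by linarith
  qed
  then show ?thesis using v by simp
qed

section \<open>A planar front below the corner\<close>

text \<open>
  Here \<open>dir \<theta>\<close> is a combination of \<open>dir \<alpha>\<close> and \<open>dir \<beta>\<close> with positive coefficients. Hence
  an upper bound on the projection onto \<open>dir \<theta>\<close> and lower bounds on the other two
  projections confine a point to a triangle.
\<close>

lemma sector_bounded:
  fixes \<alpha> \<beta> \<theta> M A :: real
  assumes s: "sin (\<beta> - \<alpha>) > 0" and s1: "sin (\<beta> - \<theta>) > 0" and s2: "sin (\<theta> - \<alpha>) > 0"
    and M: "M > 0"
  obtains R where "\<And>x z. x\<^sup>2 + z\<^sup>2 > R\<^sup>2 \<Longrightarrow> x * cos \<theta> + z * sin \<theta> \<le> A \<Longrightarrow>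
    x * cos \<alpha> + z * sin \<alpha> \<le> - M \<or> x * cos \<beta> + z * sin \<beta> \<le> - M"
proof -
  define B where "B = M + (\<bar>A\<bar> + M) / sin (\<beta> - \<theta>) + (\<bar>A\<bar> + M) / sin (\<theta> - \<alpha>)"
  have B: "B > 0" using assms by (auto simp: B_def intro!: add_pos_nonneg)
  show thesis
  proof (rule that[of "4 * B / sin (\<beta> - \<alpha>)"], rule ccontr)
    fix x z :: real
    assume far: "x\<^sup>2 + z\<^sup>2 > (4 * B / sin (\<beta> - \<alpha>))\<^sup>2" and A: "x * cos \<theta> + z * sin \<theta> \<le> A"
      and contr: "\<not> (x * cos \<alpha> + z * sin \<alpha> \<le> - M \<or> x * cos \<beta> + z * sin \<beta> \<le> - M)"
    define p where "p = x * cos \<alpha> + z * sin \<alpha>"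
    define q where "q = x * cos \<beta> + z * sin \<beta>"
    have pq: "p > - M" "q > - M" using contr by (auto simp: p_def q_def)
    have unit: "(sin \<alpha>)\<^sup>2 + (cos \<alpha>)\<^sup>2 = 1" "(sin \<beta>)\<^sup>2 + (cos \<beta>)\<^sup>2 = 1" by simp_all
    have comb: "sin (\<beta> - \<theta>) * p + sin (\<theta> - \<alpha>) * q = sin (\<beta> - \<alpha>) * (x * cos \<theta> + z * sin \<theta>)"
      unfolding p_def q_def sin_diff by algebra
    have xz: "sin (\<beta> - \<alpha>) * x = p * sin \<beta> - q * sin \<alpha>" "sin (\<beta> - \<alpha>) * z = q * cos \<alpha> - p * cos \<beta>"
      unfolding p_def q_def sin_diff by algebra+
    have "sin (\<beta> - \<alpha>) * (x * cos \<theta> + z * sin \<theta>) \<le> sin (\<beta> - \<alpha>) * \<bar>A\<bar>"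
      using A s by (intro mult_left_mono) auto
    also have "\<dots> \<le> \<bar>A\<bar>" using s by (simp add: mult_left_le_one_le)
    finally have sum_le: "sin (\<beta> - \<theta>) * p + sin (\<theta> - \<alpha>) * q \<le> \<bar>A\<bar>" using comb by simp
    have "sin (\<beta> - \<theta>) * p \<ge> sin (\<beta> - \<theta>) * (- M)" "sin (\<theta> - \<alpha>) * q \<ge> sin (\<theta> - \<alpha>) * (- M)"
      using mult_left_mono[of "- M" p "sin (\<beta> - \<theta>)"] mult_left_mono[of "- M" q "sin (\<theta> - \<alpha>)"]
        pq s1 s2 by simp_all
    moreover have "sin (\<beta> - \<theta>) * M \<le> M" "sin (\<theta> - \<alpha>) * M \<le> M"
      using M s1 s2 by (simp_all add: mult_left_le_one_le)
    ultimately have "sin (\<beta> - \<theta>) * p \<le> \<bar>A\<bar> + M" "sin (\<theta> - \<alpha>) * q \<le> \<bar>A\<bar> + M"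
      using sum_le by simp_all
    then have "p \<le> (\<bar>A\<bar> + M) / sin (\<beta> - \<theta>)" "q \<le> (\<bar>A\<bar> + M) / sin (\<theta> - \<alpha>)"
      using s1 s2 by (simp_all add: pos_le_divide_eq mult.commute)
    moreover have "(\<bar>A\<bar> + M) / sin (\<beta> - \<theta>) \<ge> 0" "(\<bar>A\<bar> + M) / sin (\<theta> - \<alpha>) \<ge> 0"
      using M s1 s2 by simp_all
    ultimately have abs: "\<bar>p\<bar> \<le> B" "\<bar>q\<bar> \<le> B" using pq M unfolding B_def by linarith+
    have prod: "\<bar>r * k\<bar> \<le> B" if "\<bar>r\<bar> \<le> B" "\<bar>k\<bar> \<le> 1" for r k :: real
      using mult_mono[OF that] B by (simp add: abs_mult)
    have "\<bar>sin (\<beta> - \<alpha>) * x\<bar> \<le> 2 * B"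
      unfolding xz using prod[OF abs(1), of "sin \<beta>"] prod[OF abs(2), of "sin \<alpha>"] by simp
    moreover have "\<bar>sin (\<beta> - \<alpha>) * z\<bar> \<le> 2 * B"
      unfolding xz using prod[OF abs(1), of "cos \<beta>"] prod[OF abs(2), of "cos \<alpha>"] by simp
    ultimately have "\<bar>x\<bar> \<le> 2 * B / sin (\<beta> - \<alpha>)" "\<bar>z\<bar> \<le> 2 * B / sin (\<beta> - \<alpha>)"
      using s by (simp_all add: abs_mult pos_le_divide_eq mult.commute)
    then have "x\<^sup>2 \<le> (2 * B / sin (\<beta> - \<alpha>))\<^sup>2" "z\<^sup>2 \<le> (2 * B / sin (\<beta> - \<alpha>))\<^sup>2"
      using B s by (simp_all add: abs_le_square_iff[symmetric])
    moreover have "(4 * B / sin (\<beta> - \<alpha>))\<^sup>2 = 4 * (2 * B / sin (\<beta> - \<alpha>))\<^sup>2"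
      by (simp add: power2_eq_square)
    ultimately show False
      using far zero_le_power2[of "2 * B / sin (\<beta> - \<alpha>)"] by linarith
  qed
qed

text \<open>
  A planar front in a direction \<open>\<theta>\<close> between \<open>\<alpha>\<close> and \<open>\<beta>\<close> that travels upwards at least as
  fast as the corner, by the hypothesis \<open>fast\<close>. The assumptions are contradictory; the
  locale carries the hypotheses through the steps that lead to \<open>False\<close>.
\<close>

locale front_below_corner =
  fixes f :: "real \<Rightarrow> real \<Rightarrow> real \<Rightarrow> real"
    and V U\<^sub>\<alpha> U\<^sub>\<beta> U\<^sub>\<theta> :: "real \<Rightarrow> real \<Rightarrow> real \<Rightarrow> real"
    and L1 L2 \<kappa> \<sigma> K \<alpha> \<beta> \<theta> c c\<^sub>\<theta> :: real
  assumes V: "classical_entire_solution f V"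
    and f0: "f x y 0 = 0"
    and lip: "\<bar>f x y r - f x y s\<bar> \<le> K * \<bar>r - s\<bar>"
    and damped: "damped f \<kappa> \<sigma>" and \<kappa>: "\<kappa> > 0" and \<sigma>: "\<sigma> > 0"
    and L: "L1 > 0" "L2 > 0"
    and angles: "0 < \<alpha>" "\<alpha> < \<theta>" "\<theta> < \<beta>" "\<beta> < pi"
    and front_\<alpha>: "pulsating_front L1 L2 f (dir \<alpha>) U\<^sub>\<alpha> (c * sin \<alpha>)"
    and front_\<beta>: "pulsating_front L1 L2 f (dir \<beta>) U\<^sub>\<beta> (c * sin \<beta>)"
    and front_\<theta>: "pulsating_front L1 L2 f (dir \<theta>) U\<^sub>\<theta> c\<^sub>\<theta>"
    and c\<^sub>\<theta>: "c\<^sub>\<theta> \<noteq> 0" and fast: "c * sin \<theta> \<le> c\<^sub>\<theta>"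
    and U\<^sub>\<alpha>_nonneg: "0 \<le> U\<^sub>\<alpha> \<xi> x y"
    and U\<^sub>\<theta>_nonneg: "0 \<le> U\<^sub>\<theta> \<xi> x y" and U\<^sub>\<theta>_le_1: "U\<^sub>\<theta> \<xi> x y \<le> 1"
    and close: "\<And>\<delta>. \<delta> > 0 \<Longrightarrow> \<exists>R. \<forall>t x y. x\<^sup>2 + (y - c * t)\<^sup>2 > R\<^sup>2 \<longrightarrow>
      \<bar>V t x y - max (U\<^sub>\<alpha> (x * cos \<alpha> + (y - c * t) * sin \<alpha>) x y)
                      (U\<^sub>\<beta> (x * cos \<beta> + (y - c * t) * sin \<beta>) x y)\<bar> \<le> \<delta>"
begin

lemma sin_pos:
  "sin (\<beta> - \<alpha>) > 0" "sin (\<beta> - \<theta>) > 0" "sin (\<theta> - \<alpha>) > 0"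
  "sin \<alpha> > 0" "sin \<beta> > 0" "sin \<theta> > 0"
  using angles by (auto intro!: sin_gt_zero)

text \<open>
  The profile \<open>U\<^sub>\<theta>\<close> in the frame of the corner. For a fixed shift it solves the equation
  if \<open>c\<^sub>\<theta> = c * sin \<theta>\<close>; otherwise the shift \<open>r\<close> of a solution decreases in time.
\<close>

definition comoving :: "real \<Rightarrow> real \<Rightarrow> real \<Rightarrow> real \<Rightarrow> real" where
  "comoving r t x y = U\<^sub>\<theta> (x * cos \<theta> + (y - c * t) * sin \<theta> + r) x y"

text \<open>
  The bound is required for all shifts \<open>r \<ge> \<rho>\<close>, since the profile is not known to be
  monotone in \<open>\<xi>\<close>. This makes the property monotone in \<open>\<rho>\<close> and lets it apply to the whole
  past of a solution through a profile.
\<close>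

definition eventually_below :: "real \<Rightarrow> bool" where
  "eventually_below \<rho> \<longleftrightarrow>
     (\<forall>\<delta>>0. \<exists>T. \<forall>t\<ge>T. \<forall>r\<ge>\<rho>. \<forall>x y. comoving r t x y - V t x y \<le> \<delta>)"

text \<open>
  This is where \<open>c * sin \<theta> \<le> c\<^sub>\<theta>\<close> enters: going back in time from \<open>t\<close>, the front lags
  behind the frame, that is, its shift only increases.
\<close>

lemma solution_through_comoving:
  obtains w where "classical_entire_solution f w"
    "\<And>x y. w t x y = comoving r t x y"
    "\<And>s. s \<le> t \<Longrightarrow> \<exists>r'\<ge>r. \<forall>x y. w s x y = comoving r' s x y"
proof -
  define k where "k = r + (c\<^sub>\<theta> - c * sin \<theta>) * t"
  define w where "w = (\<lambda>s x y. U\<^sub>\<theta> (x * cos \<theta> + y * sin \<theta> - c\<^sub>\<theta> * s + k) x y)"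
  have w: "w s x y = comoving (r + (c\<^sub>\<theta> - c * sin \<theta>) * (t - s)) s x y" for s x y
    by (simp add: w_def comoving_def k_def algebra_simps)
  show thesis
  proof (rule that[of w])
    have "classical_entire_solution f
        (\<lambda>s x y. U\<^sub>\<theta> (x * cos \<theta> + y * sin \<theta> - c\<^sub>\<theta> * (s + - k / c\<^sub>\<theta>)) x y)"
      using classical_entire_solution_time_shift[OF front_entire_solution[OF front_\<theta>]] .
    then show "classical_entire_solution f w"
      using c\<^sub>\<theta> by (simp add: w_def algebra_simps)
    show "w t x y = comoving r t x y" for x y by (simp add: w)
    show "\<exists>r'\<ge>r. \<forall>x y. w s x y = comoving r' s x y" if "s \<le> t" for s
      using that fast w by (intro exI[of _ "r + (c\<^sub>\<theta> - c * sin \<theta>) * (t - s)"]) simp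
  qed
qed

text \<open>
  If, at every point, the profile is below \<open>V\<close> or shares a monotone range of \<open>f\<close> with it,
  then errors decay exponentially, at a rate that does not depend on \<open>r\<close>.
\<close>

lemma eventually_below_if_stable:
  assumes bdd: "\<And>t r x y. T \<le> t \<Longrightarrow> \<rho> \<le> r \<Longrightarrow> comoving r t x y - V t x y \<le> M"
    and stable: "\<And>t r x y. T \<le> t \<Longrightarrow> \<rho> \<le> r \<Longrightarrow>
      1 - \<sigma> \<le> V t x y \<or> comoving r t x y \<le> \<sigma> \<or> comoving r t x y \<le> V t x y"
  shows "eventually_below \<rho>"
  unfolding eventually_below_def
proof (intro allI impI)
  fix \<delta> :: real assume "\<delta> > 0"
  obtain S where S: "S \<ge> 0" "\<And>s. s \<ge> S \<Longrightarrow> \<bar>M\<bar> * exp (- \<kappa> * s) \<le> \<delta>"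
    using exponential_decay[OF \<kappa> \<open>\<delta> > 0\<close>, of "\<bar>M\<bar>"] by blast
  show "\<exists>T. \<forall>t\<ge>T. \<forall>r\<ge>\<rho>. \<forall>x y. comoving r t x y - V t x y \<le> \<delta>"
  proof (intro exI[of _ "T + S"] allI impI)
    fix t r x y assume t: "T + S \<le> t" and r: "\<rho> \<le> r"
    obtain w where w: "classical_entire_solution f w" "\<And>x y. w t x y = comoving r t x y"
      "\<And>s. s \<le> t \<Longrightarrow> \<exists>r'\<ge>r. \<forall>x y. w s x y = comoving r' s x y"
      using solution_through_comoving[of t r] by blast
    have slice: "w s x y - V s x y \<le> M \<and>
        (1 - \<sigma> \<le> V s x y \<or> w s x y \<le> \<sigma> \<or> w s x y \<le> V s x y)" if s: "T \<le> s" "s \<le> t" for s x y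
    proof -
      obtain r' where r': "r' \<ge> r" "w s x y = comoving r' s x y" using w(3)[OF s(2)] by blast
      show ?thesis
        using bdd[OF s(1), of r' x y] stable[OF s(1), of r' x y] r r' by simp
    qed
    have "w t x y - V t x y \<le> \<bar>M\<bar> * exp (- \<kappa> * (t - T))"
    proof (rule comparison_damped[OF w(1) V \<kappa>, where B = M and T' = t])
      show "w T x y - V T x y \<le> \<bar>M\<bar>" for x y using slice[of T x y] t S(1) by linarith
    next
      fix s x y assume "T \<le> s" "s \<le> t" "V s x y < w s x y"
      then show "f x y (w s x y) - f x y (V s x y) \<le> - \<kappa> * (w s x y - V s x y)"
        using slice[of s x y] by (intro dampedD[OF damped]) auto
    qed (use slice t S(1) in auto)
    also have "\<dots> \<le> \<delta>" using S(2)[of "t - T"] t by simp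
    finally show "comoving r t x y - V t x y \<le> \<delta>" by (simp add: w(2))
  qed
qed

text \<open>
  Where the profile is not small, the point lies on or below the line carrying its
  interface, up to a bounded distance. Far from the corner that region is deep inside one
  of the two half planes where \<open>U_minus\<close> is close to 1.
\<close>

lemma stable_far_from_corner:
  obtains R where "\<And>t r x y. \<rho> \<le> r \<Longrightarrow> x\<^sup>2 + (y - c * t)\<^sup>2 > R\<^sup>2 \<Longrightarrow>
    1 - \<sigma> \<le> V t x y \<or> comoving r t x y \<le> \<sigma>"
proof -
  have \<sigma>2: "\<sigma> / 2 > 0" using \<sigma> by simp
  obtain M1 where M1: "M1 > 0" "\<And>\<xi> x y. \<xi> \<ge> M1 \<Longrightarrow> \<bar>U\<^sub>\<alpha> \<xi> x y\<bar> \<le> \<sigma> / 2"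
    "\<And>\<xi> x y. \<xi> \<le> - M1 \<Longrightarrow> \<bar>U\<^sub>\<alpha> \<xi> x y - 1\<bar> \<le> \<sigma> / 2"
    by (rule front_limits[OF front_\<alpha> \<sigma>2], rule that)
  obtain M2 where M2: "M2 > 0" "\<And>\<xi> x y. \<xi> \<ge> M2 \<Longrightarrow> \<bar>U\<^sub>\<beta> \<xi> x y\<bar> \<le> \<sigma> / 2"
    "\<And>\<xi> x y. \<xi> \<le> - M2 \<Longrightarrow> \<bar>U\<^sub>\<beta> \<xi> x y - 1\<bar> \<le> \<sigma> / 2"
    by (rule front_limits[OF front_\<beta> \<sigma>2], rule that)
  obtain M3 where M3: "M3 > 0" "\<And>\<xi> x y. \<xi> \<ge> M3 \<Longrightarrow> \<bar>U\<^sub>\<theta> \<xi> x y\<bar> \<le> \<sigma>"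
    "\<And>\<xi> x y. \<xi> \<le> - M3 \<Longrightarrow> \<bar>U\<^sub>\<theta> \<xi> x y - 1\<bar> \<le> \<sigma>"
    by (rule front_limits[OF front_\<theta> \<sigma>], rule that)
  have M: "max M1 M2 > 0" using M1 by simp
  obtain R1 where R1: "\<And>x z. x\<^sup>2 + z\<^sup>2 > R1\<^sup>2 \<Longrightarrow> x * cos \<theta> + z * sin \<theta> \<le> M3 - \<rho> \<Longrightarrow>
    x * cos \<alpha> + z * sin \<alpha> \<le> - max M1 M2 \<or> x * cos \<beta> + z * sin \<beta> \<le> - max M1 M2"
    by (rule sector_bounded[OF sin_pos(1-3) M], rule that)
  obtain R2 where R2: "\<And>t x y. x\<^sup>2 + (y - c * t)\<^sup>2 > R2\<^sup>2 \<Longrightarrow>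
      \<bar>V t x y - max (U\<^sub>\<alpha> (x * cos \<alpha> + (y - c * t) * sin \<alpha>) x y)
                      (U\<^sub>\<beta> (x * cos \<beta> + (y - c * t) * sin \<beta>) x y)\<bar> \<le> \<sigma> / 2"
    using close[OF \<sigma>2] by blast
  show thesis
  proof (rule that[of "max \<bar>R1\<bar> \<bar>R2\<bar>"])
    fix t r x y assume r: "\<rho> \<le> r" and far: "x\<^sup>2 + (y - c * t)\<^sup>2 > (max \<bar>R1\<bar> \<bar>R2\<bar>)\<^sup>2"
    have "R1\<^sup>2 \<le> (max \<bar>R1\<bar> \<bar>R2\<bar>)\<^sup>2" "R2\<^sup>2 \<le> (max \<bar>R1\<bar> \<bar>R2\<bar>)\<^sup>2"
      by (simp_all add: abs_le_square_iff[symmetric])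
    then have far': "x\<^sup>2 + (y - c * t)\<^sup>2 > R1\<^sup>2" "x\<^sup>2 + (y - c * t)\<^sup>2 > R2\<^sup>2"
      using far by linarith+
    show "1 - \<sigma> \<le> V t x y \<or> comoving r t x y \<le> \<sigma>"
    proof (cases "x * cos \<theta> + (y - c * t) * sin \<theta> \<le> M3 - \<rho>")
      case True
      from R1[OF far'(1) True]
      have "U\<^sub>\<alpha> (x * cos \<alpha> + (y - c * t) * sin \<alpha>) x y \<ge> 1 - \<sigma> / 2 \<or>
          U\<^sub>\<beta> (x * cos \<beta> + (y - c * t) * sin \<beta>) x y \<ge> 1 - \<sigma> / 2"
      proof
        assume "x * cos \<alpha> + (y - c * t) * sin \<alpha> \<le> - max M1 M2"
        then have "x * cos \<alpha> + (y - c * t) * sin \<alpha> \<le> - M1" by linarith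
        from M1(3)[OF this, of x y] show ?thesis by linarith
      next
        assume "x * cos \<beta> + (y - c * t) * sin \<beta> \<le> - max M1 M2"
        then have "x * cos \<beta> + (y - c * t) * sin \<beta> \<le> - M2" by linarith
        from M2(3)[OF this, of x y] show ?thesis by linarith
      qed
      then have "1 - \<sigma> \<le> V t x y" using R2[OF far'(2)] by linarith
      then show ?thesis ..
    next
      case False
      then have "comoving r t x y \<le> \<sigma>"
      proof -
        have "x * cos \<theta> + (y - c * t) * sin \<theta> + r \<ge> M3" using r False by linarith
        from M3(2)[OF this, of x y] show ?thesis unfolding comoving_def by linarith
      qed
      then show ?thesis ..
    qed
  qed
qed

text \<open>
  Away from the corner \<open>V\<close> is close to a nonnegative function, and near the corner it is
  bounded by compactness, but only on bounded time intervals. Comparison with the solution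
  0 then carries the bound at time 0 to all later times.
\<close>

lemma solution_bounded_below:
  obtains S where "\<And>t x y. t \<ge> 0 \<Longrightarrow> V t x y \<ge> - S"
proof -
  obtain R where R: "\<And>t x y. x\<^sup>2 + (y - c * t)\<^sup>2 > R\<^sup>2 \<Longrightarrow>
      \<bar>V t x y - max (U\<^sub>\<alpha> (x * cos \<alpha> + (y - c * t) * sin \<alpha>) x y)
                      (U\<^sub>\<beta> (x * cos \<beta> + (y - c * t) * sin \<beta>) x y)\<bar> \<le> 1"
    using close[of 1] by auto
  have bdd: "\<exists>B\<ge>1. \<forall>t x y. 0 \<le> t \<longrightarrow> t \<le> T \<longrightarrow> 0 - V t x y \<le> B" for T
  proof -
    define N where "N = \<bar>R\<bar> + \<bar>c\<bar> * \<bar>T\<bar>"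
    define Q where "Q = {0..T} \<times> {-N..N} \<times> {-N..N}"
    have "continuous_on Q (\<lambda>(t, x, y). V t x y)"
      by (rule continuous_on_subset[OF classical_entire_solutionD(7)[OF V]]) simp
    moreover have "compact Q" unfolding Q_def by (intro compact_Times compact_Icc)
    ultimately have "compact ((\<lambda>(t, x, y). V t x y) ` Q)"
      by (rule compact_continuous_image)
    then obtain B where B: "\<And>v. v \<in> (\<lambda>(t, x, y). V t x y) ` Q \<Longrightarrow> \<bar>v\<bar> \<le> B"
      using compact_imp_bounded bounded_real by metis
    show ?thesis
    proof (intro exI[of _ "max 1 B"] conjI allI impI)
      fix t x y assume t: "0 \<le> t" "t \<le> T"
      show "0 - V t x y \<le> max 1 B"
      proof (cases "x\<^sup>2 + (y - c * t)\<^sup>2 > R\<^sup>2")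
        case True
        from R[OF this] U\<^sub>\<alpha>_nonneg[of "x * cos \<alpha> + (y - c * t) * sin \<alpha>" x y]
        have "0 - V t x y \<le> 1" by linarith
        then show ?thesis by simp
      next
        case False
        then have "\<not> \<bar>R\<bar> < \<bar>x\<bar>" "\<not> \<bar>R\<bar> < \<bar>y - c * t\<bar>"
          using square_less_sum_squares by blast+
        moreover have "\<bar>c * t\<bar> \<le> \<bar>c\<bar> * \<bar>T\<bar>" using t by (auto simp: abs_mult intro!: mult_left_mono)
        moreover have "\<bar>c\<bar> * \<bar>T\<bar> \<ge> 0" by simp
        ultimately have "\<bar>x\<bar> \<le> N" "\<bar>y\<bar> \<le> N" unfolding N_def by linarith+
        then have "(t, x, y) \<in> Q" using t by (auto simp: Q_def abs_le_iff)
        from B[OF imageI[OF this]] show ?thesis by auto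
      qed
    qed simp
  qed
  obtain S where S: "S \<ge> 1" "\<And>x y. 0 - V 0 x y \<le> S" using bdd[of 0] by auto
  show thesis
  proof (rule that[of S])
    fix t x y :: real assume t: "t \<ge> 0"
    obtain B where B: "\<And>s x y. 0 \<le> s \<Longrightarrow> s \<le> t \<Longrightarrow> 0 - V s x y \<le> B" using bdd[of t] by auto
    have "0 - V t x y \<le> S * exp (- \<kappa> * (t - 0))"
    proof (rule comparison_damped[OF classical_entire_solution_const V \<kappa>, where B = B and T' = t])
      show "f x y 0 - f x y (V s x y) \<le> - \<kappa> * (0 - V s x y)" if "V s x y < 0" for s x y
        using dampedD[OF damped that] \<sigma> by simp
      show "0 - V s x y \<le> B" if "0 \<le> s" "s \<le> t" for s x y using B[OF that] .
    qed (use f0 S t in simp_all)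
    also have "\<dots> \<le> S" using S t \<kappa> by (simp add: mult_left_le)
    finally show "V t x y \<ge> - S" by simp
  qed
qed

text \<open>
  A large shift makes the profile small near the corner as well, so the stability
  condition holds everywhere.
\<close>

lemma eventually_below_start: "\<exists>\<rho>. eventually_below \<rho>"
proof -
  obtain R where R: "\<And>t r x y. 0 \<le> r \<Longrightarrow> x\<^sup>2 + (y - c * t)\<^sup>2 > R\<^sup>2 \<Longrightarrow>
    1 - \<sigma> \<le> V t x y \<or> comoving r t x y \<le> \<sigma>"
    by (rule stable_far_from_corner[of 0], rule that)
  obtain S where S: "\<And>t x y. t \<ge> 0 \<Longrightarrow> V t x y \<ge> - S"
    by (rule solution_bounded_below, rule that)
  obtain M where M: "M > 0" "\<And>\<xi> x y. \<xi> \<ge> M \<Longrightarrow> \<bar>U\<^sub>\<theta> \<xi> x y\<bar> \<le> \<sigma>"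
    "\<And>\<xi> x y. \<xi> \<le> - M \<Longrightarrow> \<bar>U\<^sub>\<theta> \<xi> x y - 1\<bar> \<le> \<sigma>"
    by (rule front_limits[OF front_\<theta> \<sigma>], rule that)
  have "eventually_below (M + \<bar>R\<bar>)"
  proof (rule eventually_below_if_stable[where T = 0 and M = "1 + S"])
    show "comoving r t x y - V t x y \<le> 1 + S" if "0 \<le> t" for t r x y :: real
      using S[OF that, of x y] U\<^sub>\<theta>_le_1[of "x * cos \<theta> + (y - c * t) * sin \<theta> + r" x y]
      by (simp add: comoving_def)
    fix t r x y :: real assume t: "0 \<le> t" and r: "M + \<bar>R\<bar> \<le> r"
    show "1 - \<sigma> \<le> V t x y \<or> comoving r t x y \<le> \<sigma> \<or> comoving r t x y \<le> V t x y"
    proof (cases "x\<^sup>2 + (y - c * t)\<^sup>2 > R\<^sup>2")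
      case True
      moreover have "0 \<le> r" using r M(1) by linarith
      ultimately show ?thesis using R[of r x y t] by blast
    next
      case False
      then have "\<bar>x * cos \<theta> + (y - c * t) * sin \<theta>\<bar> \<le> \<bar>R\<bar>" by (intro projection_le) auto
      then have "x * cos \<theta> + (y - c * t) * sin \<theta> + r \<ge> M" using r by linarith
      from M(2)[OF this, of x y] have "comoving r t x y \<le> \<sigma>" by (simp add: comoving_def)
      then show ?thesis by blast
    qed
  qed
  then show ?thesis ..
qed

lemma eventually_below_mono:
  assumes "eventually_below \<rho>" and le: "\<rho> \<le> \<rho>'"
  shows "eventually_below \<rho>'"
  unfolding eventually_below_def
proof (intro allI impI)
  fix \<delta> :: real assume "\<delta> > 0"
  then obtain T where T: "\<forall>t\<ge>T. \<forall>r\<ge>\<rho>. \<forall>x y. comoving r t x y - V t x y \<le> \<delta>"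
    using assms(1) unfolding eventually_below_def by blast
  show "\<exists>T. \<forall>t\<ge>T. \<forall>r\<ge>\<rho>'. \<forall>x y. comoving r t x y - V t x y \<le> \<delta>"
    by (rule exI[of _ T]) (use T order_trans[OF le] in simp)
qed

lemma eventually_below_perturb:
  assumes "\<delta> > 0"
  obtains \<eta> where "\<eta> > 0" "\<eta> \<le> 1" "\<And>\<rho>. eventually_below \<rho> \<Longrightarrow>
    \<exists>T. \<forall>t\<ge>T. \<forall>r\<ge>\<rho>-\<eta>. \<forall>x y. comoving r t x y - V t x y \<le> \<delta>"
proof -
  have \<delta>2: "\<delta> / 2 > 0" using assms by simp
  obtain \<eta> where \<eta>: "\<eta> > 0" "\<eta> \<le> 1"
    "\<And>\<xi> \<xi>' x y. \<bar>\<xi> - \<xi>'\<bar> \<le> \<eta> \<Longrightarrow> \<bar>U\<^sub>\<theta> \<xi> x y - U\<^sub>\<theta> \<xi>' x y\<bar> \<le> \<delta> / 2"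
    by (rule front_uniformly_continuous[OF front_\<theta> c\<^sub>\<theta> L \<delta>2], rule that)
  show thesis
  proof (rule that[OF \<eta>(1,2)])
    fix \<rho> assume "eventually_below \<rho>"
    then obtain T where T: "\<And>t r x y. t \<ge> T \<Longrightarrow> r \<ge> \<rho> \<Longrightarrow> comoving r t x y - V t x y \<le> \<delta> / 2"
      using \<delta>2 unfolding eventually_below_def by blast
    show "\<exists>T. \<forall>t\<ge>T. \<forall>r\<ge>\<rho>-\<eta>. \<forall>x y. comoving r t x y - V t x y \<le> \<delta>"
    proof (intro exI[of _ T] allI impI)
      fix t r x y assume t: "T \<le> t" and r: "\<rho> - \<eta> \<le> r"
      have "\<bar>comoving r t x y - comoving (max r \<rho>) t x y\<bar> \<le> \<delta> / 2"
        unfolding comoving_def using r \<eta>(1) by (intro \<eta>(3)) auto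
      then show "comoving r t x y - V t x y \<le> \<delta>" using T[OF t, of "max r \<rho>" x y] by linarith
    qed
  qed
qed

lemma eventually_below_closed:
  assumes "\<And>r. r > \<rho> \<Longrightarrow> eventually_below r"
  shows "eventually_below \<rho>"
  unfolding eventually_below_def
proof (intro allI impI)
  fix \<delta> :: real assume "\<delta> > 0"
  obtain \<eta> where \<eta>: "\<eta> > 0" "\<And>\<rho>. eventually_below \<rho> \<Longrightarrow>
      \<exists>T. \<forall>t\<ge>T. \<forall>r\<ge>\<rho>-\<eta>. \<forall>x y. comoving r t x y - V t x y \<le> \<delta>"
    by (rule eventually_below_perturb[OF \<open>\<delta> > 0\<close>], rule that)
  have "eventually_below (\<rho> + \<eta>)" using \<eta>(1) by (intro assms) simp
  from \<eta>(2)[OF this] show "\<exists>T. \<forall>t\<ge>T. \<forall>r\<ge>\<rho>. \<forall>x y. comoving r t x y - V t x y \<le> \<delta>"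
    by simp
qed

text \<open>
  Straight above the corner, at a fixed height \<open>Y\<close>, both fronts are small and so is \<open>V\<close>,
  while the profile with a very negative shift is close to 1 there.
\<close>

lemma eventually_below_not_all: "\<exists>\<rho>. \<not> eventually_below \<rho>"
proof -
  obtain M1 where M1: "M1 > 0" "\<And>\<xi> x y. \<xi> \<ge> M1 \<Longrightarrow> \<bar>U\<^sub>\<alpha> \<xi> x y\<bar> \<le> 1/8"
    "\<And>\<xi> x y. \<xi> \<le> - M1 \<Longrightarrow> \<bar>U\<^sub>\<alpha> \<xi> x y - 1\<bar> \<le> 1/8"
    by (rule front_limits[OF front_\<alpha>, where \<epsilon> = "1/8"], simp, rule that)
  obtain M2 where M2: "M2 > 0" "\<And>\<xi> x y. \<xi> \<ge> M2 \<Longrightarrow> \<bar>U\<^sub>\<beta> \<xi> x y\<bar> \<le> 1/8"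
    "\<And>\<xi> x y. \<xi> \<le> - M2 \<Longrightarrow> \<bar>U\<^sub>\<beta> \<xi> x y - 1\<bar> \<le> 1/8"
    by (rule front_limits[OF front_\<beta>, where \<epsilon> = "1/8"], simp, rule that)
  obtain M3 where M3: "M3 > 0" "\<And>\<xi> x y. \<xi> \<ge> M3 \<Longrightarrow> \<bar>U\<^sub>\<theta> \<xi> x y\<bar> \<le> 1/8"
    "\<And>\<xi> x y. \<xi> \<le> - M3 \<Longrightarrow> \<bar>U\<^sub>\<theta> \<xi> x y - 1\<bar> \<le> 1/8"
    by (rule front_limits[OF front_\<theta>, where \<epsilon> = "1/8"], simp, rule that)
  obtain R where R: "\<And>t x y. x\<^sup>2 + (y - c * t)\<^sup>2 > R\<^sup>2 \<Longrightarrow>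
      \<bar>V t x y - max (U\<^sub>\<alpha> (x * cos \<alpha> + (y - c * t) * sin \<alpha>) x y)
                      (U\<^sub>\<beta> (x * cos \<beta> + (y - c * t) * sin \<beta>) x y)\<bar> \<le> 1/8"
    using close[of "1/8"] by auto
  define Y where "Y = \<bar>R\<bar> + 1 + M1 / sin \<alpha> + M2 / sin \<beta>"
  have Y: "Y * sin \<alpha> \<ge> M1" "Y * sin \<beta> \<ge> M2" "Y > \<bar>R\<bar>"
  proof -
    have nonneg: "M1 / sin \<alpha> \<ge> 0" "M2 / sin \<beta> \<ge> 0"
      using M1(1) M2(1) sin_pos by simp_all
    then show "Y > \<bar>R\<bar>" by (simp add: Y_def)
    have "Y \<ge> M1 / sin \<alpha>" "Y \<ge> M2 / sin \<beta>" using nonneg unfolding Y_def by linarith+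
    then show "Y * sin \<alpha> \<ge> M1" "Y * sin \<beta> \<ge> M2"
      using sin_pos by (simp_all add: pos_divide_le_eq)
  qed
  have "\<not> eventually_below (- M3 - Y * sin \<theta>)"
  proof
    assume "eventually_below (- M3 - Y * sin \<theta>)"
    moreover have "(1/8::real) > 0" by simp
    ultimately obtain t where
      "comoving (- M3 - Y * sin \<theta>) t 0 (c * t + Y) - V t 0 (c * t + Y) \<le> 1/8"
      unfolding eventually_below_def by (meson order_refl)
    moreover have "comoving (- M3 - Y * sin \<theta>) t 0 (c * t + Y) \<ge> 7/8"
    proof -
      have "\<bar>U\<^sub>\<theta> (- M3) 0 (c * t + Y) - 1\<bar> \<le> 1/8" by (rule M3(3)) simp
      then have "U\<^sub>\<theta> (- M3) 0 (c * t + Y) \<ge> 7/8" by linarith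
      then show ?thesis by (simp add: comoving_def)
    qed
    moreover have "V t 0 (c * t + Y) \<le> 1/4"
    proof -
      have "R\<^sup>2 < 0\<^sup>2 + (c * t + Y - c * t)\<^sup>2"
        by (rule square_less_sum_squares) (use Y in simp)
      from R[OF this]
      have "\<bar>V t 0 (c * t + Y) - max (U\<^sub>\<alpha> (Y * sin \<alpha>) 0 (c * t + Y)) (U\<^sub>\<beta> (Y * sin \<beta>) 0 (c * t + Y))\<bar>
          \<le> 1/8" by simp
      then show ?thesis
        using M1(2)[OF Y(1), of 0 "c * t + Y"] M2(2)[OF Y(2), of 0 "c * t + Y"] by linarith
    qed
    ultimately show False by linarith
  qed
  then show ?thesis ..
qed

text \<open>
  The error \<open>\<delta>\<close> and the gain \<open>\<eta>\<close> are chosen so small that the gap which spreads from the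
  side of the corner outweighs them. The gap comes from a unit ball around \<open>(X, Z)\<close> in the
  moving frame, between the line and the arm of the V with normal \<open>dir \<alpha>\<close>: there \<open>V\<close> is
  near 1 and the profile near 0. One unit of time later it yields \<open>V \<ge> comoving r\<close> in the
  disc of radius \<open>\<bar>R\<bar>\<close> around the corner; outside that disc stability takes over.
\<close>

lemma eventually_below_improve:
  assumes below: "eventually_below \<rho>"
  shows "\<exists>\<eta>>0. eventually_below (\<rho> - \<eta>)"
proof -
  obtain R where R: "\<And>t r x y. \<rho> - 1 \<le> r \<Longrightarrow> x\<^sup>2 + (y - c * t)\<^sup>2 > R\<^sup>2 \<Longrightarrow>
    1 - \<sigma> \<le> V t x y \<or> comoving r t x y \<le> \<sigma>"
    by (rule stable_far_from_corner[of "\<rho> - 1"], rule that)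
  obtain M1 where M1: "M1 > 0" "\<And>\<xi> x y. \<xi> \<ge> M1 \<Longrightarrow> \<bar>U\<^sub>\<alpha> \<xi> x y\<bar> \<le> 1/8"
    "\<And>\<xi> x y. \<xi> \<le> - M1 \<Longrightarrow> \<bar>U\<^sub>\<alpha> \<xi> x y - 1\<bar> \<le> 1/8"
    by (rule front_limits[OF front_\<alpha>, where \<epsilon> = "1/8"], simp, rule that)
  obtain M3 where M3: "M3 > 0" "\<And>\<xi> x y. \<xi> \<ge> M3 \<Longrightarrow> \<bar>U\<^sub>\<theta> \<xi> x y\<bar> \<le> 1/8"
    "\<And>\<xi> x y. \<xi> \<le> - M3 \<Longrightarrow> \<bar>U\<^sub>\<theta> \<xi> x y - 1\<bar> \<le> 1/8"
    by (rule front_limits[OF front_\<theta>, where \<epsilon> = "1/8"], simp, rule that)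
  obtain R1 where R1: "\<And>t x y. x\<^sup>2 + (y - c * t)\<^sup>2 > R1\<^sup>2 \<Longrightarrow>
      \<bar>V t x y - max (U\<^sub>\<alpha> (x * cos \<alpha> + (y - c * t) * sin \<alpha>) x y)
                      (U\<^sub>\<beta> (x * cos \<beta> + (y - c * t) * sin \<beta>) x y)\<bar> \<le> 1/8"
    using close[of "1/8"] by auto
  \<comment> \<open>a point whose projection onto \<open>dir \<alpha>\<close> is below \<open>- M\<close> is also farther than \<open>\<bar>R1\<bar>\<close> from the corner\<close>
  define M where "M = M1 + \<bar>R1\<bar>"
  obtain X Z where XZ: "X * cos \<alpha> + Z * sin \<alpha> \<le> - M - 2" "X * cos \<theta> + Z * sin \<theta> \<ge> M3 - \<rho> + 2"
  proof (rule that)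
    have "sin (\<theta> - \<alpha>) > 0" by (rule sin_pos)
    then show "(- (M + 2) * sin \<theta> - (M3 - \<rho> + 2) * sin \<alpha>) / sin (\<theta> - \<alpha>) * cos \<alpha>
          + ((M3 - \<rho> + 2) * cos \<alpha> - - (M + 2) * cos \<theta>) / sin (\<theta> - \<alpha>) * sin \<alpha> \<le> - M - 2"
      and "(- (M + 2) * sin \<theta> - (M3 - \<rho> + 2) * sin \<alpha>) / sin (\<theta> - \<alpha>) * cos \<theta>
          + ((M3 - \<rho> + 2) * cos \<alpha> - - (M + 2) * cos \<theta>) / sin (\<theta> - \<alpha>) * sin \<theta> \<ge> M3 - \<rho> + 2"
      using corner_coordinates[of \<theta> \<alpha>, OF _ refl refl, of "- (M + 2)" "M3 - \<rho> + 2"] by simp_all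
  qed
  \<comment> \<open>so large that the disc of radius \<open>\<bar>R\<bar>\<close> around the corner lies within \<open>D / sqrt 2\<close> of the
    position of \<open>(X, Z)\<close> one unit of time earlier\<close>
  define D where "D = sqrt (1 + 4 * (R\<^sup>2 + X\<^sup>2 + (c - Z)\<^sup>2))"
  have D: "D \<ge> 1" "D\<^sup>2 = 1 + 4 * (R\<^sup>2 + X\<^sup>2 + (c - Z)\<^sup>2)" by (simp_all add: D_def)
  define \<delta> where "\<delta> = spread_bound K D / exp K"
  have \<delta>: "\<delta> > 0" "spread_bound K D - exp K * \<delta> = 0"
    using spread_bound_pos[OF D(1), of K] by (simp_all add: \<delta>_def)
  obtain \<eta> where \<eta>: "\<eta> > 0" "\<eta> \<le> 1"
    "\<exists>T. \<forall>t\<ge>T. \<forall>r\<ge>\<rho>-\<eta>. \<forall>x y. comoving r t x y - V t x y \<le> \<delta>"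
    using eventually_below_perturb[OF \<delta>(1)] below by metis
  then obtain T where T: "\<And>t r x y. T \<le> t \<Longrightarrow> \<rho> - \<eta> \<le> r \<Longrightarrow> comoving r t x y - V t x y \<le> \<delta>"
    by blast
  have "eventually_below (\<rho> - \<eta>)"
  proof (rule eventually_below_if_stable[where T = "T + 1" and M = \<delta>])
    show "comoving r t x y - V t x y \<le> \<delta>" if "T + 1 \<le> t" "\<rho> - \<eta> \<le> r" for t r x y
      by (rule T) (use that in auto)
    fix t r x y assume t: "T + 1 \<le> t" and r: "\<rho> - \<eta> \<le> r"
    show "1 - \<sigma> \<le> V t x y \<or> comoving r t x y \<le> \<sigma> \<or> comoving r t x y \<le> V t x y"
    proof (cases "x\<^sup>2 + (y - c * t)\<^sup>2 > R\<^sup>2")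
      case True
      moreover have "\<rho> - 1 \<le> r" using r \<eta>(2) by linarith
      ultimately show ?thesis using R[of r x y t] by blast
    next
      case False
      obtain w where w: "classical_entire_solution f w" "\<And>x y. w t x y = comoving r t x y"
        "\<And>s. s \<le> t \<Longrightarrow> \<exists>r'\<ge>r. \<forall>x y. w s x y = comoving r' s x y"
        using solution_through_comoving[of t r] by blast
      have "V (t - 1 + 1) x y - w (t - 1 + 1) x y \<ge> spread_bound K D - exp K * \<delta>"
      proof (rule positivity_spreads[OF V w(1) lip D(1), where p = X and q = "c * (t - 1) + Z"])
        fix s x y assume s: "t - 1 \<le> s" "s \<le> t - 1 + 1"
        then obtain r' where "r' \<ge> r" "w s x y = comoving r' s x y" using w(3)[of s] by auto
        then show "- \<delta> \<le> V s x y - w s x y" using T[of s r' x y] s t r by simp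
      next
        fix x y assume near: "(x - X)\<^sup>2 + (y - (c * (t - 1) + Z))\<^sup>2 \<le> 1"
        define z where "z = y - c * (t - 1)"
        have "\<bar>(x - X) * cos \<phi> + (z - Z) * sin \<phi>\<bar> \<le> 1" for \<phi>
          using near by (intro projection_le) (auto simp: z_def algebra_simps)
        from this[of \<alpha>] this[of \<theta>] XZ
        have \<alpha>: "x * cos \<alpha> + z * sin \<alpha> \<le> - M - 1" and \<theta>: "x * cos \<theta> + z * sin \<theta> \<ge> M3 - \<rho> + 1"
          by (auto simp: algebra_simps abs_le_iff)
        obtain r' where r': "r' \<ge> r" "w (t - 1) x y = comoving r' (t - 1) x y"
          using w(3)[of "t - 1"] by auto
        have "w (t - 1) x y \<le> 1/8"
        proof -
          have "x * cos \<theta> + z * sin \<theta> + r' \<ge> M3" using \<theta> r'(1) r \<eta>(2) by linarith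
          from M3(2)[OF this, of x y] show ?thesis
            unfolding r'(2) comoving_def z_def[symmetric] by linarith
        qed
        moreover have "U\<^sub>\<alpha> (x * cos \<alpha> + z * sin \<alpha>) x y \<ge> 7/8"
        proof -
          have "x * cos \<alpha> + z * sin \<alpha> \<le> - M1" using \<alpha> by (simp add: M_def)
          from M1(3)[OF this, of x y] show ?thesis by linarith
        qed
        moreover have "R1\<^sup>2 < x\<^sup>2 + z\<^sup>2"
        proof -
          have "\<bar>R1\<bar> < \<bar>x * cos \<alpha> + z * sin \<alpha>\<bar>" using \<alpha> M1(1) by (simp add: M_def)
          then have "R1\<^sup>2 < (x * cos \<alpha> + z * sin \<alpha>)\<^sup>2 + 0\<^sup>2"
            by (intro square_less_sum_squares) simp
          then show ?thesis using projection_square_le[of x \<alpha> z] by simp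
        qed
        ultimately show "1/4 \<le> V (t - 1) x y - w (t - 1) x y"
          using R1[of x y "t - 1"] unfolding z_def by linarith
      next
        have "(p - q)\<^sup>2 \<le> 2 * p\<^sup>2 + 2 * q\<^sup>2" for p q :: real
          using zero_le_power2[of "p + q"] by (simp add: power2_sum power2_diff)
        from this[of x X] this[of "y - c * t" "Z - c"]
        have "(x - X)\<^sup>2 + (y - (c * (t - 1) + Z))\<^sup>2
            \<le> 2 * (x\<^sup>2 + (y - c * t)\<^sup>2) + 2 * X\<^sup>2 + 2 * (c - Z)\<^sup>2"
          by (simp add: algebra_simps power2_commute)
        then show "(x - X)\<^sup>2 + (y - (c * (t - 1) + Z))\<^sup>2 \<le> D\<^sup>2 / 2"
          using False unfolding D by argo
      qed (use \<delta> in simp)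
      then show ?thesis using \<delta>(2) w(2) by simp
    qed
  qed
  then show ?thesis using \<eta>(1) by blast
qed

text \<open>
  The set of admissible shifts is an up-set that is nonempty, bounded below and closed,
  yet none of its elements is least.
\<close>

lemma front_below_corner_impossible: False
proof -
  define S where "S = {\<rho>. eventually_below \<rho>}"
  obtain \<rho>0 where "\<not> eventually_below \<rho>0" using eventually_below_not_all by blast
  then have lower: "\<rho>0 \<le> \<rho>" if "\<rho> \<in> S" for \<rho>
    using that eventually_below_mono[of \<rho> \<rho>0] unfolding S_def by (meson le_cases mem_Collect_eq)
  have "S \<noteq> {}" using eventually_below_start by (simp add: S_def)
  have "eventually_below (Inf S)"
  proof (rule eventually_below_closed)
    fix r assume "r > Inf S"
    then obtain \<rho> where "\<rho> \<in> S" "\<rho> < r" using cInf_lessD[OF \<open>S \<noteq> {}\<close>] by blast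
    then show "eventually_below r" using eventually_below_mono[of \<rho> r] by (simp add: S_def)
  qed
  then obtain \<eta> where "\<eta> > 0" "Inf S - \<eta> \<in> S"
    using eventually_below_improve by (auto simp: S_def)
  moreover have "Inf S \<le> Inf S - \<eta>"
    by (rule cInf_lower[OF calculation(2)]) (use lower in \<open>auto simp: bdd_below_def\<close>)
  ultimately show False by simp
qed

end

section \<open>The theorem\<close>

lemma near_if_sup_tendsto_zero:
  fixes g :: "real \<Rightarrow> real \<Rightarrow> real \<Rightarrow> real"
  assumes lim: "((\<lambda>R::real. SUP (t, x, y) \<in> {(t, x, y). x\<^sup>2 + (y - c * t)\<^sup>2 > R\<^sup>2}.
      ereal \<bar>g t x y\<bar>) \<longlongrightarrow> 0) at_top"
    and "\<delta> > 0"
  shows "\<exists>R. \<forall>t x y. x\<^sup>2 + (y - c * t)\<^sup>2 > R\<^sup>2 \<longrightarrow> \<bar>g t x y\<bar> \<le> \<delta>"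
proof -
  have "\<forall>\<^sub>F R in at_top. (SUP (t, x, y) \<in> {(t, x, y). x\<^sup>2 + (y - c * t)\<^sup>2 > R\<^sup>2}.
      ereal \<bar>g t x y\<bar>) < ereal \<delta>"
    using order_tendstoD(2)[OF lim, of "ereal \<delta>"] \<open>\<delta> > 0\<close> by simp
  then obtain R where R: "(SUP (t, x, y) \<in> {(t, x, y). x\<^sup>2 + (y - c * t)\<^sup>2 > R\<^sup>2}.
      ereal \<bar>g t x y\<bar>) < ereal \<delta>"
    unfolding eventually_at_top_linorder by blast
  have "\<bar>g t x y\<bar> \<le> \<delta>" if "x\<^sup>2 + (y - c * t)\<^sup>2 > R\<^sup>2" for t x y
  proof -
    have "ereal \<bar>g t x y\<bar> \<le> (SUP (t, x, y) \<in> {(t, x, y). x\<^sup>2 + (y - c * t)\<^sup>2 > R\<^sup>2}.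
        ereal \<bar>g t x y\<bar>)"
      using that by (intro SUP_upper2[of "(t, x, y)"]) auto
    then have "ereal \<bar>g t x y\<bar> < ereal \<delta>" using R by (rule le_less_trans)
    then show ?thesis by simp
  qed
  then show ?thesis by blast
qed

theorem theorem1p7:
  fixes L1 L2 :: real
    and f :: "real \<Rightarrow> real \<Rightarrow> real \<Rightarrow> real"
    and U :: "real \<times> real \<Rightarrow> real \<Rightarrow> real \<Rightarrow> real \<Rightarrow> real"
    and c :: "real \<times> real \<Rightarrow> real"
    and \<alpha> \<beta> c\<^sub>\<alpha>\<^sub>\<beta> :: real
    and V :: "real \<Rightarrow> real \<Rightarrow> real \<Rightarrow> real"
  assumes "L1 > 0" and "L2 > 0"
    and "F1 f" and "F2 L1 L2 f" and "F3 f"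
    and "integral ({0..L1} \<times> {0..L2} \<times> {0..1}) (\<lambda>(x, y, u). f x y u) > 0"
    and fronts: "\<And>e. norm e = 1 \<Longrightarrow>
          pulsating_front L1 L2 f e (U e) (c e) \<and> c e \<noteq> 0 \<and> U e 0 0 0 = 1/2"
    and "0 < \<alpha>" and "\<alpha> < \<beta>" and "\<beta> < pi"
    and "c\<^sub>\<alpha>\<^sub>\<beta> > 0"
    and "classical_entire_solution f V"
    and "((\<lambda>R::real. SUP (t, x, y) \<in> {(t, x, y). x\<^sup>2 + (y - c\<^sub>\<alpha>\<^sub>\<beta> * t)\<^sup>2 > R\<^sup>2}.
            ereal \<bar>V t x y - U_minus U c \<alpha> \<beta> t x y\<bar>) \<longlongrightarrow> 0) at_top"
  shows "c\<^sub>\<alpha>\<^sub>\<beta> = c (dir \<alpha>) / sin \<alpha> \<and>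
         c (dir \<alpha>) / sin \<alpha> = c (dir \<beta>) / sin \<beta> \<and>
         (\<forall>\<theta>\<in>{\<alpha><..<\<beta>}. c (dir \<beta>) / sin \<beta> > c (dir \<theta>) / sin \<theta>)"
proof -
  have unit: "norm (dir \<phi>) = 1" for \<phi> by (simp add: dir_def norm_Pair)
  have front: "pulsating_front L1 L2 f (dir \<phi>) (U (dir \<phi>)) (c (dir \<phi>))" and c_ne: "c (dir \<phi>) \<noteq> 0"
    for \<phi> using fronts[OF unit] by blast+
  obtain K where K: "\<And>x y. K-lipschitz_on UNIV (f x y)"
    using \<open>F3 f\<close> unfolding F3_def by blast
  have lip: "\<bar>f x y r - f x y s\<bar> \<le> K * \<bar>r - s\<bar>" for x y r s
    using lipschitz_onD[OF K, of r s x y] by (simp add: dist_real_def)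
  obtain \<kappa> \<sigma> where \<kappa>: "\<kappa> > 0" and \<sigma>: "0 < \<sigma>"
    and fu: "\<And>x y u. u \<in> {..\<sigma>} \<union> {1-\<sigma>..} \<Longrightarrow> - f_u f x y u \<ge> \<kappa>"
    using \<open>F3 f\<close> unfolding F3_def by (metis greaterThanLessThan_iff)
  have f0: "f x y 0 = 0" "f x y 1 = 0" for x y using \<open>F3 f\<close> by (simp_all add: F3_def)
  have damped: "damped f \<kappa> \<sigma>"
    by (rule damped_if_derivative_bound[OF _ fu]) (use \<open>F1 f\<close> in \<open>auto simp: F1_def\<close>)
  \<comment> \<open>the bounds hold along the solution, and every \<open>\<xi>\<close> is reached at a suitable time as the speed is nonzero\<close>
  have range: "0 \<le> U (dir \<phi>) \<xi> x y" "U (dir \<phi>) \<xi> x y \<le> 1" for \<phi> \<xi> x y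
  proof -
    obtain B where B: "\<And>\<xi> x y. \<bar>U (dir \<phi>) \<xi> x y\<bar> \<le> B"
      using front_bounded[OF front c_ne \<open>L1 > 0\<close> \<open>L2 > 0\<close>] by metis
    have "0 \<le> U (dir \<phi>) (x * cos \<phi> + y * sin \<phi> - c (dir \<phi>) * t) x y"
      "U (dir \<phi>) (x * cos \<phi> + y * sin \<phi> - c (dir \<phi>) * t) x y \<le> 1" for t
      using bounded_entire_solution_range[OF front_entire_solution[OF front] B f0 damped \<kappa> \<sigma>]
      by blast+
    from this[of "(x * cos \<phi> + y * sin \<phi> - \<xi>) / c (dir \<phi>)"]
    show "0 \<le> U (dir \<phi>) \<xi> x y" "U (dir \<phi>) \<xi> x y \<le> 1" using c_ne[of \<phi>] by simp_all
  qed
  have close: "\<exists>R. \<forall>t x y. x\<^sup>2 + (y - c\<^sub>\<alpha>\<^sub>\<beta> * t)\<^sup>2 > R\<^sup>2 \<longrightarrow>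
      \<bar>V t x y - max (U (dir \<alpha>) (x * cos \<alpha> + y * sin \<alpha> - c (dir \<alpha>) * t) x y)
                      (U (dir \<beta>) (x * cos \<beta> + y * sin \<beta> - c (dir \<beta>) * t) x y)\<bar> \<le> \<delta>"
    if "\<delta> > 0" for \<delta>
    using near_if_sup_tendsto_zero[OF assms(13) that] unfolding U_minus_def .
  have sin_pos: "sin \<phi> > 0" if "\<alpha> \<le> \<phi>" "\<phi> \<le> \<beta>" for \<phi>
    using that assms(8-10) by (intro sin_gt_zero) auto
  have "sin (\<beta> - \<alpha>) > 0" using assms(8-10) by (intro sin_gt_zero) auto
  then have speeds: "c (dir \<alpha>) = c\<^sub>\<alpha>\<^sub>\<beta> * sin \<alpha>" "c (dir \<beta>) = c\<^sub>\<alpha>\<^sub>\<beta> * sin \<beta>"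
    using corner_velocity[OF \<open>classical_entire_solution f V\<close> front front _ lip close] by blast+
  have comoving_frame: "x * cos \<phi> + y * sin \<phi> - c\<^sub>\<alpha>\<^sub>\<beta> * sin \<phi> * t
      = x * cos \<phi> + (y - c\<^sub>\<alpha>\<^sub>\<beta> * t) * sin \<phi>" for x y t \<phi>
    by (simp add: algebra_simps)
  have "c (dir \<theta>) < c\<^sub>\<alpha>\<^sub>\<beta> * sin \<theta>" if \<theta>: "\<theta> \<in> {\<alpha><..<\<beta>}" for \<theta>
  proof (rule ccontr)
    assume slow: "\<not> c (dir \<theta>) < c\<^sub>\<alpha>\<^sub>\<beta> * sin \<theta>"
    interpret front_below_corner f V "U (dir \<alpha>)" "U (dir \<beta>)" "U (dir \<theta>)" L1 L2
      \<kappa> \<sigma> K \<alpha> \<beta> \<theta> c\<^sub>\<alpha>\<^sub>\<beta> "c (dir \<theta>)"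
      by (rule front_below_corner.intro[OF assms(12) f0(1) lip damped \<kappa> \<sigma> assms(1,2,8) _ _ assms(10)
          front[of \<alpha>, unfolded speeds] front[of \<beta>, unfolded speeds] front c_ne _
          range(1) range close[unfolded speeds comoving_frame]])
        (use \<theta> slow in auto)
    show False by (rule front_below_corner_impossible)
  qed
  then have "c (dir \<theta>) / sin \<theta> < c\<^sub>\<alpha>\<^sub>\<beta>" if "\<theta> \<in> {\<alpha><..<\<beta>}" for \<theta>
    using that sin_pos[of \<theta>] by (simp add: pos_divide_less_eq)
  then show ?thesis
    using speeds sin_pos[of \<alpha>] sin_pos[of \<beta>] assms(9) by simp
qed

end
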